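(* Consider a Markov decision process with finite state space $\mathcal{S}$, finite action space $\mathcal{A}$, reward function $r:\mathcal{S}\times\mathcal{A}\to\mathbb{R}$, transition function $p(s'|s,a)$, initial distribution $p_0$ and discount factor $\gamma\in[0,1)$. Data are generated by a behavior policy $\mu$: $S_0\sim p_0$, $A_t\sim\mu(\cdot|S_t)$, $S_{t+1}\sim p(\cdot|S_t,A_t)$. Assume the Markov chain $\{(S_t,A_t,S_{t+1})\}_{t\ge0}$ is irreducible and aperiodic. Let $q_0\in\mathbb{R}^{\mathcal{S}\times\mathcal{A}}$ and define $Q$-learning iterates $$q_{t+1}(s,a)=q_t(s,a)+\alpha_t\big(r(S_t,A_t)+\gamma\max_{a'}q_t(S_{t+1},a')-q_t(s,a)\big)\ \text{if }(s,a)=(S_t,A_t),\qquad q_{t+1}(s,a)=q_t(s,a)\ \text{otherwise}.$$ Let $q_*$ be the unique fixed point of the Bellman optimality operator $(\mathcal{T}_*q)(s,a)=r(s,a)+\gamma\sum_{s'}p(s'|s,a)\max_{a'}q(s',a')$. (i) If $\alpha_t=\frac{C_\alpha}{(t+3)^{\nu}}$ with $C_\alpha>0$ and $\nu\in(\frac23,1]$, then: if $\nu<1$, for every $\zeta\in(0,\frac32\nu-1)$, $\lim_{t\to\infty}t^\zeta\|q_t-q_*\|_\infty^2=0$ a.s.; if $\nu=1$, for every $\zeta\in(0,1)$ and $\nu_1>0$, $\lim_{t\to\infty}\exp(\zeta\ln^{1/(1+\nu_1)}t)\|q_t-q_*\|_\infty^2=0$ a.s. (ii) If $\alpha_t=\frac{C_\alpha}{(t+3)\ln^\nu(t+3)}$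 with $C_\alpha>0$ and $\nu\in(0,1)$, then there exists a deterministic $\bar C_\alpha$ such that whenever $C_\alpha\ge\bar C_\alpha$ there exist deterministic constants $C,C'$ and a positive integer $K$ such that for any $\delta\in(0,1)$, with probability at least $1-\delta$, for all $t\ge0$, $$\|q_t-q_*\|_\infty^2\le C\exp\Big(\frac{-\ln^{1-\nu}(t+1)}{1-\nu}\Big)\Big[\log\frac1\delta+C'+\frac{\ln^{1-\nu}(t+1)}{1-\nu}\Big]^K.$$
   Context: $\|\cdot\|_\infty$ denotes the maximum norm on $\mathbb{R}^{\mathcal{S}\times\mathcal{A}}$. *)

theory Defs
  imports "HOL-Probability.Probability"
begin

text \<open>Transition kernel of the Markov chain of triples (S_t, A_t, S_{t+1}) induced by
  the behaviour policy mu and transition probabilities p: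
  from (s,a,s') the chain moves to (u,b,u') with probability mu(b|u) p(u'|u,b) if u = s'.\<close>
definition Kmat :: "('s \<Rightarrow> 'a \<Rightarrow> real) \<Rightarrow> ('s \<Rightarrow> 'a \<Rightarrow> 's \<Rightarrow> real)
    \<Rightarrow> ('s \<times> 'a \<times> 's) \<Rightarrow> ('s \<times> 'a \<times> 's) \<Rightarrow> real" where
  "Kmat mu p x y =
     (if fst y = snd (snd x) then mu (fst y) (fst (snd y)) * p (fst y) (fst (snd y)) (snd (snd y))
      else 0)"

fun Kpow :: "('s \<Rightarrow> 'a \<Rightarrow> real) \<Rightarrow> ('s \<Rightarrow> 'a \<Rightarrow> 's \<Rightarrow> real) \<Rightarrow> nat
    \<Rightarrow> ('s::finite \<times> 'a::finite \<times> 's) \<Rightarrow> ('s \<times> 'a \<times> 's) \<Rightarrow> real" where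
  "Kpow mu p 0 x y = (if x = y then 1 else 0)"
| "Kpow mu p (Suc n) x y = (\<Sum>z\<in>UNIV. Kpow mu p n x z * Kmat mu p z y)"

definition triple_space :: "('s \<Rightarrow> 'a \<Rightarrow> 's \<Rightarrow> real) \<Rightarrow> ('s \<times> 'a \<times> 's) set" where
  "triple_space p = {(s, a, s'). p s a s' > 0}"

definition chain_irreducible :: "('s \<Rightarrow> 'a \<Rightarrow> real) \<Rightarrow> ('s \<Rightarrow> 'a \<Rightarrow> 's \<Rightarrow> real)
    \<Rightarrow> ('s::finite \<times> 'a::finite \<times> 's) set \<Rightarrow> bool" where
  "chain_irreducible mu p Y \<longleftrightarrow> (\<forall>x\<in>Y. \<forall>y\<in>Y. \<exists>n. Kpow mu p n x y > 0)"

definition chain_aperiodic :: "('s \<Rightarrow> 'a \<Rightarrow> real) \<Rightarrow> ('s \<Rightarrow> 'a \<Rightarrow> 's \<Rightarrow> real)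
    \<Rightarrow> ('s::finite \<times> 'a::finite \<times> 's) set \<Rightarrow> bool" where
  "chain_aperiodic mu p Y \<longleftrightarrow> (\<forall>x\<in>Y. Gcd {n. n > 0 \<and> Kpow mu p n x x > 0} = (1::nat))"

primrec qlearn :: "('s \<Rightarrow> 'a \<Rightarrow> real) \<Rightarrow> real \<Rightarrow> (nat \<Rightarrow> real) \<Rightarrow> ('s \<Rightarrow> 'a::finite \<Rightarrow> real)
    \<Rightarrow> (nat \<Rightarrow> 's) \<Rightarrow> (nat \<Rightarrow> 'a) \<Rightarrow> nat \<Rightarrow> 's \<Rightarrow> 'a \<Rightarrow> real" where
  "qlearn r \<gamma> \<alpha> q0 S A 0 = q0"
| "qlearn r \<gamma> \<alpha> q0 S A (Suc t) =
     (let q = qlearn r \<gamma> \<alpha> q0 S A t in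
      (\<lambda>s a. if (s, a) = (S t, A t)
              then q s a + \<alpha> t * (r (S t) (A t) + \<gamma> * Max (range (q (S (Suc t)))) - q s a)
              else q s a))"

definition bellman :: "('s::finite \<Rightarrow> 'a::finite \<Rightarrow> real) \<Rightarrow> real \<Rightarrow> ('s \<Rightarrow> 'a \<Rightarrow> 's \<Rightarrow> real)
    \<Rightarrow> ('s \<Rightarrow> 'a \<Rightarrow> real) \<Rightarrow> 's \<Rightarrow> 'a \<Rightarrow> real" where
  "bellman r \<gamma> p q s a = r s a + \<gamma> * (\<Sum>s'\<in>UNIV. p s a s' * Max (range (q s')))"

definition supnorm :: "('s::finite \<Rightarrow> 'a::finite \<Rightarrow> real) \<Rightarrow> real" where
  "supnorm q = Max (range (\<lambda>(s, a). \<bar>q s a\<bar>))"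

end

theory Submission
  imports Defs "HOL-Real_Asymp.Real_Asymp"
begin

text \<open>The error at the pair visited at time \<open>t\<close> is replaced by a convex combination of itself and a
  \<open>\<gamma>\<close>-contraction of the whole error vector, up to a martingale difference.  Given a growth rate
  \<open>g\<close> that increases by at most a factor \<open>exp (c * \<alpha> t)\<close> per step, three ingredients show that
  from a late time \<open>m\<close> on the error is at most \<open>C * g m / g t\<close> with high probability: the noise
  accumulated with weights \<open>g\<close> stays small (Azuma's inequality in maximal form); by
  irreducibility every pair is visited often enough, in the sense that the step sizes spent on it
  keep up with a fixed proportion of all step sizes (again Azuma, applied to the martingale of a
  hitting time drift function); and on the event where both hold the decay follows path by path.
  Polynomial \<open>g\<close> gives the almost sure rates, \<open>g\<close> with \<open>(g t)\<^sup>2 = exp (ln (t + 3) powr (1 - \<nu>) / (1 - \<nu>))\<close>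
  the high probability bound, where \<open>m\<close> has to be of the order of \<open>(ln (1 / \<delta>))\<^sup>2\<close>.\<close>

section \<open>A maximal Azuma inequality for finite Markov chains\<close>

text \<open>Only one coordinate moves per step, so the maximum norm of the error need not shrink: a
  pair that stays unvisited keeps its stale error and feeds it to the others. The bound is therefore
  proved for an envelope with a separate weight for each pair, and the weights stay comparable only
  if visits recur at a fixed rate. That rate is \<open>d = 1 / (H + 1)\<close>, with
  \<open>H\<close> a bound for all drift functions, and the contraction leaves the slack
  \<open>1 - \<gamma>\<close>; the admissible growth \<open>c\<close> of \<open>g\<close> is a fixed
  multiple of their product. The threshold on \<open>C\<alpha>\<close> for logarithmic steps and the
  limit on the exponent for \<open>\<nu> = 1\<close> both come from \<open>c\<close>. The noise is
  only known to be bounded, not to shrink with the error, so its \<open>g\<close>-weighted variance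
  has to be summable. For polynomial steps this asks for an exponent of the squared error below
  \<open>2 * \<nu> - 1\<close>, which leaves room above \<open>3/2 * \<nu> - 1\<close>. The iterates
  obey one deterministic bound on all paths, so the error at the late time \<open>m\<close> needs no
  prior estimate and each rate is obtained in one pass.\<close>

lemma exp_le_add_exp_square: "exp x \<le> x + exp (x\<^sup>2)" for x :: real
proof -
  have e: "1 + x\<^sup>2 \<le> exp (x\<^sup>2)" by (rule exp_ge_add_one_self)
  consider "x \<ge> 1" | "0 \<le> x" "x \<le> 1" | "-1 \<le> x" "x \<le> 0" | "x \<le> -1" by linarith
  then show ?thesis
  proof cases
    case 1
    then have "x \<le> x\<^sup>2" by (simp add: power2_eq_square)
    then have "exp x \<le> exp (x\<^sup>2)" by simp
    with 1 show ?thesis by linarith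
  next
    case 2
    then have "exp x \<le> 1 + x + x\<^sup>2" by (intro exp_bound) auto
    with e show ?thesis by linarith
  next
    case 3
    \<comment> \<open>On \<open>[-1, 0]\<close> the bound
      \<open>exp x \<le> 1 + x + x\<^sup>2\<close> comes from multiplying
      \<open>1 - x \<le> exp (- x)\<close> by the quadratic: the product \<open>1 - x ^ 3\<close> is
      at least 1.\<close>
    have "1 - x \<le> exp (- x)" using exp_ge_add_one_self[of "-x"] by simp
    moreover have "(1 - x) * (1 + x + x\<^sup>2) = 1 - x ^ 3" by algebra
    moreover have "x ^ 3 \<le> 0" using 3 by (simp add: power3_eq_cube mult_nonneg_nonpos)
    moreover have "1 + x + x\<^sup>2 \<ge> 0" using 3 by (simp add: add_nonneg_nonneg)
    ultimately have "1 \<le> exp (- x) * (1 + x + x\<^sup>2)"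
      using mult_right_mono[of "1 - x" "exp (- x)" "1 + x + x\<^sup>2"] by linarith
    then have "exp x * 1 \<le> exp x * (exp (- x) * (1 + x + x\<^sup>2))" by (intro mult_left_mono) auto
    also have "\<dots> = 1 + x + x\<^sup>2" by (simp add: exp_minus_inverse mult.assoc[symmetric])
    finally show ?thesis using e by linarith
  next
    case 4
    then have "1 * (- x) \<le> (- x) * (- x)" by (intro mult_right_mono) auto
    moreover have "exp x \<le> 1" using 4 by simp
    moreover have "(- x) * (- x) = x\<^sup>2" by (simp add: power2_eq_square)
    ultimately show ?thesis using e by linarith
  qed
qed

text \<open>Plays the role of adaptedness to a filtration. Random quantities are written as
  functionals of the whole path, so that conditioning on the past becomes a finite sum over the
  updated coordinate \<open>x(Suc n := y)\<close>.\<close>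

definition depends_upto :: "nat \<Rightarrow> ((nat \<Rightarrow> 'x) \<Rightarrow> 'b) \<Rightarrow> bool" where
  "depends_upto n f \<longleftrightarrow> (\<forall>x y. (\<forall>k\<le>n. x k = y k) \<longrightarrow> f x = f y)"

lemma depends_uptoD: "depends_upto n f \<Longrightarrow> (\<And>k. k \<le> n \<Longrightarrow> x k = y k) \<Longrightarrow> f x = f y"
  by (auto simp: depends_upto_def)

locale finite_chain = prob_space M for M :: "'w measure" +
  fixes X :: "nat \<Rightarrow> 'w \<Rightarrow> 'x::finite"
    and init :: "'x \<Rightarrow> real"
    and P :: "'x \<Rightarrow> 'x \<Rightarrow> real"
  assumes X_measurable [measurable]: "\<And>t. X t \<in> measurable M (count_space UNIV)"
    and P_nonneg: "\<And>x y. 0 \<le> P x y"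
    and P_sum: "\<And>x. (\<Sum>y\<in>UNIV. P x y) = 1"
    and path_law: "\<And>n x. prob {\<omega> \<in> space M. \<forall>k\<le>n. X k \<omega> = x k}
      = init (x 0) * (\<Prod>k<n. P (x k) (x (Suc k)))"
begin

abbreviation path :: "'w \<Rightarrow> nat \<Rightarrow> 'x" where
  "path \<omega> \<equiv> (\<lambda>k. X k \<omega>)"

abbreviation paths :: "nat \<Rightarrow> (nat \<Rightarrow> 'x) set" where
  "paths n \<equiv> PiE {..n} (\<lambda>_. UNIV)"

abbreviation cylinder :: "nat \<Rightarrow> (nat \<Rightarrow> 'x) \<Rightarrow> 'w set" where
  "cylinder n x \<equiv> {\<omega> \<in> space M. \<forall>k\<le>n. X k \<omega> = x k}"

lemma finite_paths: "finite (paths n)"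
  by (intro finite_PiE) auto

lemma cylinder_sets [measurable]: "cylinder n x \<in> sets M"
  by measurable

text \<open>\<open>PiE\<close> makes the paths up to time \<open>n\<close> a finite set; its members
  are \<open>undefined\<close> beyond \<open>n\<close>, which is harmless because \<open>f\<close>
  ignores those coordinates. Expectations of path functionals thus reduce to finite sums over
  cylinders.\<close>

lemma path_function_expansion:
  fixes f :: "(nat \<Rightarrow> 'x) \<Rightarrow> real"
  assumes f: "depends_upto n f" and \<omega>: "\<omega> \<in> space M"
  shows "f (path \<omega>) = (\<Sum>z\<in>paths n. f z * indicator (cylinder n z) \<omega>)"
proof -
  define z0 where "z0 = restrict (path \<omega>) {..n}"
  have z0: "z0 \<in> paths n" by (auto simp: z0_def)
  have iff: "indicator (cylinder n z) \<omega> = (if z = z0 then 1 else 0 :: real)" if "z \<in> paths n" for z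
  proof -
    have "(\<forall>k\<le>n. X k \<omega> = z k) \<longleftrightarrow> z = z0"
    proof
      assume "\<forall>k\<le>n. X k \<omega> = z k"
      then show "z = z0" using that z0
        by (intro PiE_ext[OF that z0]) (auto simp: z0_def)
    qed (auto simp: z0_def)
    then show ?thesis using \<omega> by (auto simp: indicator_def)
  qed
  have "(\<Sum>z\<in>paths n. f z * indicator (cylinder n z) \<omega>) = (\<Sum>z\<in>paths n. if z = z0 then f z else 0)"
    by (intro sum.cong refl) (simp add: iff)
  also have "\<dots> = f z0" using z0 finite_paths by simp
  also have "\<dots> = f (path \<omega>)" by (rule depends_uptoD[OF f]) (simp add: z0_def)
  finally show ?thesis by simp
qed

lemma path_function_measurable:
  fixes f :: "(nat \<Rightarrow> 'x) \<Rightarrow> real"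
  assumes f: "depends_upto n f"
  shows "(\<lambda>\<omega>. f (path \<omega>)) \<in> borel_measurable M"
proof -
  have "(\<lambda>\<omega>. \<Sum>z\<in>paths n. f z * indicator (cylinder n z) \<omega>) \<in> borel_measurable M"
    by measurable
  then show ?thesis
    by (rule measurable_cong[THEN iffD1, rotated]) (simp add: path_function_expansion[OF f])
qed

lemma path_function_integral:
  fixes f :: "(nat \<Rightarrow> 'x) \<Rightarrow> real"
  assumes f: "depends_upto n f"
  shows "integrable M (\<lambda>\<omega>. f (path \<omega>))"
    and "expectation (\<lambda>\<omega>. f (path \<omega>)) = (\<Sum>z\<in>paths n. f z * prob (cylinder n z))"
proof -
  have int: "integrable M (\<lambda>\<omega>. f z * indicator (cylinder n z) \<omega>)" for z
    by (intro integrable_mult_right integrable_real_indicator) (auto simp: emeasure_eq_measure)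
  have "integrable M (\<lambda>\<omega>. \<Sum>z\<in>paths n. f z * indicator (cylinder n z) \<omega>)"
    using int by (intro Bochner_Integration.integrable_sum)
  then show "integrable M (\<lambda>\<omega>. f (path \<omega>))"
    by (rule Bochner_Integration.integrable_cong[THEN iffD1, rotated 2])
      (simp_all add: path_function_expansion[OF f])
  have "expectation (\<lambda>\<omega>. f (path \<omega>)) = expectation (\<lambda>\<omega>. \<Sum>z\<in>paths n. f z * indicator (cylinder n z) \<omega>)"
    by (intro Bochner_Integration.integral_cong refl) (simp add: path_function_expansion[OF f])
  also have "\<dots> = (\<Sum>z\<in>paths n. expectation (\<lambda>\<omega>. f z * indicator (cylinder n z) \<omega>))"
    using int by (intro Bochner_Integration.integral_sum)
  also have "\<dots> = (\<Sum>z\<in>paths n. f z * prob (cylinder n z))"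
    by (intro sum.cong refl) (simp add: Int_absorb2)
  finally show "expectation (\<lambda>\<omega>. f (path \<omega>)) = (\<Sum>z\<in>paths n. f z * prob (cylinder n z))" .
qed

text \<open>The tower property: the inner sum is the conditional expectation given the path up to
  \<open>n\<close>. It holds because \<open>path_law\<close> makes the weight of a cylinder up to
  \<open>Suc n\<close> the weight of its restriction times one transition probability.\<close>

lemma expectation_path_Suc:
  fixes f :: "(nat \<Rightarrow> 'x) \<Rightarrow> real"
  assumes f: "depends_upto (Suc n) f"
  shows "expectation (\<lambda>\<omega>. f (path \<omega>))
    = expectation (\<lambda>\<omega>. \<Sum>y\<in>UNIV. P (X n \<omega>) y * f ((path \<omega>)(Suc n := y)))"
proof -
  have dep: "depends_upto n (\<lambda>x. \<Sum>y\<in>UNIV. P (x n) y * f (x(Suc n := y)))"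
    unfolding depends_upto_def
  proof (intro allI impI sum.cong refl)
    fix x z :: "nat \<Rightarrow> 'x" and y assume "\<forall>k\<le>n. x k = z k"
    then have "f (x(Suc n := y)) = f (z(Suc n := y))" by (intro depends_uptoD[OF f]) auto
    with \<open>\<forall>k\<le>n. x k = z k\<close> show "P (x n) y * f (x(Suc n := y)) = P (z n) y * f (z(Suc n := y))" by simp
  qed
  have w: "prob (cylinder (Suc n) (z(Suc n := y))) = prob (cylinder n z) * P (z n) y" for z y
  proof -
    have "(\<Prod>k<n. P ((z(Suc n := y)) k) ((z(Suc n := y)) (Suc k))) = (\<Prod>k<n. P (z k) (z (Suc k)))"
      by (intro prod.cong refl) auto
    then show ?thesis by (simp add: path_law del: fun_upd_apply) (simp add: path_law)
  qed
  have "{..Suc n} = insert (Suc n) {..n}" by auto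
  then have img: "paths (Suc n) = (\<lambda>(y, g). g(Suc n := y)) ` (UNIV \<times> paths n)"
    by (simp add: PiE_insert_eq)
  have inj: "inj_on (\<lambda>(y, g). g(Suc n := y)) (UNIV \<times> paths n)"
    by (rule inj_combinator) simp
  have "expectation (\<lambda>\<omega>. f (path \<omega>)) = (\<Sum>z\<in>paths (Suc n). f z * prob (cylinder (Suc n) z))"
    by (rule path_function_integral(2)[OF f])
  also have "\<dots> = (\<Sum>(y, z)\<in>UNIV \<times> paths n. f (z(Suc n := y)) * (prob (cylinder n z) * P (z n) y))"
    unfolding img by (subst sum.reindex[OF inj]) (intro sum.cong refl, simp only: o_def split_beta w)
  also have "\<dots> = (\<Sum>y\<in>UNIV. \<Sum>z\<in>paths n. f (z(Suc n := y)) * (prob (cylinder n z) * P (z n) y))"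
    by (rule sum.cartesian_product[symmetric])
  also have "\<dots> = (\<Sum>z\<in>paths n. \<Sum>y\<in>UNIV. f (z(Suc n := y)) * (prob (cylinder n z) * P (z n) y))"
    by (rule sum.swap)
  also have "\<dots> = (\<Sum>z\<in>paths n. (\<Sum>y\<in>UNIV. P (z n) y * f (z(Suc n := y))) * prob (cylinder n z))"
    by (intro sum.cong refl) (simp add: sum_distrib_right sum_distrib_left mult_ac)
  also have "\<dots> = expectation (\<lambda>\<omega>. \<Sum>y\<in>UNIV. P (X n \<omega>) y * f ((path \<omega>)(Suc n := y)))"
    by (rule path_function_integral(2)[OF dep, symmetric])
  finally show ?thesis .
qed

section \<open>Maximal inequalities for adapted functionals of the path\<close>

lemma supermartingale_maximal_inequality:
  fixes U :: "nat \<Rightarrow> (nat \<Rightarrow> 'x) \<Rightarrow> real"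
  assumes dep: "\<And>n. depends_upto n (U n)"
    and nonneg: "\<And>n x. 0 \<le> U n x"
    and init: "\<And>x. U 0 x \<le> 1"
    and step: "\<And>n x. (\<Sum>y\<in>UNIV. P (x n) y * U (Suc n) (x(Suc n := y))) \<le> U n x"
    and l: "0 < l"
  shows "prob {\<omega> \<in> space M. \<exists>n. l \<le> U n (path \<omega>)} \<le> 1 / l"
proof -
  \<comment> \<open>Stopping at the first passage above l reduces the maximal inequality to Markov's.\<close>
  define T where "T n x = (if \<exists>k\<le>n. l \<le> U k x then l else U n x)" for n x
  have depT: "depends_upto n (T n)" for n
    unfolding depends_upto_def
  proof (intro allI impI)
    fix x y :: "nat \<Rightarrow> 'x" assume *: "\<forall>k\<le>n. x k = y k"
    have "U k x = U k y" if "k \<le> n" for k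
      using depends_uptoD[OF dep[of k], of x y] * that by auto
    then show "T n x = T n y" by (auto simp: T_def)
  qed
  have Tstep: "(\<Sum>y\<in>UNIV. P (x n) y * T (Suc n) (x(Suc n := y))) \<le> T n x" for n x
  proof (cases "\<exists>k\<le>n. l \<le> U k x")
    case True
    then obtain k where k: "k \<le> n" "l \<le> U k x" by auto
    have "U k (x(Suc n := y)) = U k x" for y
      using k by (intro depends_uptoD[OF dep]) auto
    with k have "T (Suc n) (x(Suc n := y)) = l" for y
      unfolding T_def by (metis le_SucI)
    then have "(\<Sum>y\<in>UNIV. P (x n) y * T (Suc n) (x(Suc n := y))) = l"
      by (simp add: sum_distrib_right[symmetric] P_sum)
    with True show ?thesis by (simp add: T_def)
  next
    case False
    have eq: "U k (x(Suc n := y)) = U k x" if "k \<le> n" for y k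
      using that by (intro depends_uptoD[OF dep]) auto
    have "T (Suc n) (x(Suc n := y)) \<le> U (Suc n) (x(Suc n := y))" for y
      using False eq unfolding T_def by (auto simp: le_Suc_eq)
    then have "(\<Sum>y\<in>UNIV. P (x n) y * T (Suc n) (x(Suc n := y)))
        \<le> (\<Sum>y\<in>UNIV. P (x n) y * U (Suc n) (x(Suc n := y)))"
      by (intro sum_mono mult_left_mono P_nonneg)
    also have "\<dots> \<le> U n x" by (rule step)
    also have "U n x = T n x" using False by (auto simp: T_def)
    finally show ?thesis .
  qed
  have ET: "expectation (\<lambda>\<omega>. T n (path \<omega>)) \<le> 1" for n
  proof (induction n)
    case 0
    have "T 0 x \<le> 1" for x using init[of x] by (auto simp: T_def)
    then have "expectation (\<lambda>\<omega>. T 0 (path \<omega>)) \<le> expectation (\<lambda>_. 1)"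
      by (intro integral_mono path_function_integral(1)[OF depT]) auto
    then show ?case by (simp add: prob_space)
  next
    case (Suc n)
    have d: "depends_upto n (\<lambda>x. \<Sum>y\<in>UNIV. P (x n) y * T (Suc n) (x(Suc n := y)))"
      unfolding depends_upto_def
    proof (intro allI impI sum.cong refl)
      fix x z :: "nat \<Rightarrow> 'x" and y assume *: "\<forall>k\<le>n. x k = z k"
      then have "T (Suc n) (x(Suc n := y)) = T (Suc n) (z(Suc n := y))"
        by (intro depends_uptoD[OF depT]) auto
      with * show "P (x n) y * T (Suc n) (x(Suc n := y)) = P (z n) y * T (Suc n) (z(Suc n := y))" by simp
    qed
    have "expectation (\<lambda>\<omega>. T (Suc n) (path \<omega>)) \<le> expectation (\<lambda>\<omega>. T n (path \<omega>))"
      unfolding expectation_path_Suc[OF depT]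
      by (intro integral_mono path_function_integral(1)[OF depT] path_function_integral(1)[OF d] Tstep)
    with Suc show ?case by simp
  qed
  define E where "E n = {\<omega> \<in> space M. \<exists>k\<le>n. l \<le> U k (path \<omega>)}" for n
  have Umeas [measurable]: "(\<lambda>\<omega>. U k (path \<omega>)) \<in> borel_measurable M" for k
    by (rule path_function_measurable[OF dep])
  have E_sets [measurable]: "E n \<in> sets M" for n unfolding E_def by measurable
  have PE: "prob (E n) \<le> 1 / l" for n
  proof -
    have "l * prob (E n) = expectation (\<lambda>\<omega>. l * indicator (E n) \<omega>)"
      by (simp add: Int_absorb2 sets.sets_into_space)
    also have "\<dots> \<le> expectation (\<lambda>\<omega>. T n (path \<omega>))"
    proof (intro integral_mono path_function_integral(1)[OF depT])
      show "integrable M (\<lambda>\<omega>. l * indicator (E n) \<omega>)"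
        by (intro integrable_mult_right integrable_real_indicator) (auto simp: emeasure_eq_measure)
      show "l * indicator (E n) \<omega> \<le> T n (path \<omega>)" for \<omega>
        using nonneg l by (auto simp: T_def E_def indicator_def)
    qed
    also have "\<dots> \<le> 1" by (rule ET)
    finally show ?thesis using l by (simp add: field_simps)
  qed
  \<comment> \<open>The bound for a finite horizon does not depend on \<open>n\<close> and the
    events increase, so continuity from below extends it to the unbounded horizon.\<close>
  have "(\<lambda>n. prob (E n)) \<longlonglongrightarrow> prob (\<Union>n. E n)"
    by (rule finite_Lim_measure_incseq) (auto simp: E_def incseq_def intro: order_trans)
  then have "prob (\<Union>n. E n) \<le> 1 / l"
    by (rule LIMSEQ_le_const2) (use PE in auto)
  moreover have "(\<Union>n. E n) = {\<omega> \<in> space M. \<exists>n. l \<le> U n (path \<omega>)}"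
    by (auto simp: E_def)
  ultimately show ?thesis by simp
qed

text \<open>The exponential of \<open>\<theta>\<close> times the sum, compensated by
  \<open>\<theta>\<^sup>2\<close> times the summed squares of \<open>b\<close>, is a nonnegative
  supermartingale started at 1, so the maximal inequality treats all times at once. Using
  \<open>exp x \<le> x + exp (x\<^sup>2)\<close> in place of Hoeffding's lemma puts 4 instead of 2
  into the denominator.\<close>

lemma azuma_one_sided:
  fixes W :: "nat \<Rightarrow> (nat \<Rightarrow> 'x) \<Rightarrow> real"
  assumes dep: "\<And>k. depends_upto (Suc k) (W k)"
    and mean: "\<And>k x. (\<Sum>y\<in>UNIV. P (x k) y * W k (x(Suc k := y))) = 0"
    and bound: "\<And>k x. \<bar>W k x\<bar> \<le> b k"
    and V: "\<And>n. (\<Sum>k<n. (b k)\<^sup>2) \<le> V" "0 < V"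
    and e: "0 < e"
  shows "prob {\<omega> \<in> space M. \<exists>n. e \<le> (\<Sum>k<n. W k (path \<omega>))} \<le> exp (- e\<^sup>2 / (4 * V))"
proof -
  \<comment> \<open>The maximizer of \<open>\<theta> * e - \<theta>\<^sup>2 * V\<close>; the maximum
    is \<open>e\<^sup>2 / (4 * V)\<close>.\<close>
  define \<theta> where "\<theta> = e / (2 * V)"
  have \<theta>: "\<theta> > 0" using V e by (simp add: \<theta>_def)
  define U where "U n x = exp (\<theta> * (\<Sum>k<n. W k x) - \<theta>\<^sup>2 * (\<Sum>k<n. (b k)\<^sup>2))" for n x
  have depS: "(\<Sum>k<n. W k x) = (\<Sum>k<n. W k y)" if "\<And>k. k \<le> n \<Longrightarrow> x k = y k" for n x y
    using that by (intro sum.cong refl depends_uptoD[OF dep]) auto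
  have depU: "depends_upto n (U n)" for n
    unfolding depends_upto_def U_def using depS by metis
  have stepU: "(\<Sum>y\<in>UNIV. P (x n) y * U (Suc n) (x(Suc n := y))) \<le> U n x" for n x
  proof -
    have S: "(\<Sum>k<n. W k (x(Suc n := y))) = (\<Sum>k<n. W k x)" for y by (rule depS) auto
    have "P (x n) y * exp (\<theta> * W n (x(Suc n := y)))
        \<le> \<theta> * (P (x n) y * W n (x(Suc n := y))) + P (x n) y * exp (\<theta>\<^sup>2 * (b n)\<^sup>2)" for y
    proof -
      let ?w = "W n (x(Suc n := y))"
      have "?w\<^sup>2 \<le> (b n)\<^sup>2" using bound[of n "x(Suc n := y)"]
        by (metis abs_ge_zero order_trans power2_abs power_mono)
      then have "exp ((\<theta> * ?w)\<^sup>2) \<le> exp (\<theta>\<^sup>2 * (b n)\<^sup>2)"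
        using \<theta> by (simp add: power_mult_distrib mult_left_mono)
      with exp_le_add_exp_square[of "\<theta> * ?w"]
      have "exp (\<theta> * ?w) \<le> \<theta> * ?w + exp (\<theta>\<^sup>2 * (b n)\<^sup>2)" by linarith
      from mult_left_mono[OF this P_nonneg[of "x n" y]] show ?thesis by (simp add: algebra_simps)
    qed
    \<comment> \<open>Summation over \<open>y\<close> kills the linear term by \<open>mean\<close>,
      and the transition weights of the constant term add up to 1.\<close>
    then have "(\<Sum>y\<in>UNIV. P (x n) y * exp (\<theta> * W n (x(Suc n := y))))
        \<le> (\<Sum>y\<in>UNIV. \<theta> * (P (x n) y * W n (x(Suc n := y))) + P (x n) y * exp (\<theta>\<^sup>2 * (b n)\<^sup>2))"
      by (intro sum_mono)
    also have "\<dots> = exp (\<theta>\<^sup>2 * (b n)\<^sup>2)"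
      by (simp add: sum.distrib sum_distrib_left[symmetric] sum_distrib_right[symmetric] mean P_sum)
    finally have 1: "(\<Sum>y\<in>UNIV. P (x n) y * exp (\<theta> * W n (x(Suc n := y)))) \<le> exp (\<theta>\<^sup>2 * (b n)\<^sup>2)" .
    have 2: "P (x n) y * U (Suc n) (x(Suc n := y))
      = (U n x * exp (- (\<theta>\<^sup>2 * (b n)\<^sup>2))) * (P (x n) y * exp (\<theta> * W n (x(Suc n := y))))" for y
    proof -
      have "\<theta> * (\<Sum>k<Suc n. W k (x(Suc n := y))) - \<theta>\<^sup>2 * (\<Sum>k<Suc n. (b k)\<^sup>2)
          = (\<theta> * (\<Sum>k<n. W k x) - \<theta>\<^sup>2 * (\<Sum>k<n. (b k)\<^sup>2)) + - (\<theta>\<^sup>2 * (b n)\<^sup>2)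
            + \<theta> * W n (x(Suc n := y))"
        by (simp only: sum.lessThan_Suc S) (simp add: algebra_simps)
      then show ?thesis unfolding U_def by (simp only: exp_add mult_ac)
    qed
    have "(\<Sum>y\<in>UNIV. P (x n) y * U (Suc n) (x(Suc n := y)))
      = (U n x * exp (- (\<theta>\<^sup>2 * (b n)\<^sup>2))) * (\<Sum>y\<in>UNIV. P (x n) y * exp (\<theta> * W n (x(Suc n := y))))"
      by (simp only: 2 sum_distrib_left)
    also have "\<dots> \<le> (U n x * exp (- (\<theta>\<^sup>2 * (b n)\<^sup>2))) * exp (\<theta>\<^sup>2 * (b n)\<^sup>2)"
      by (intro mult_left_mono 1) (simp add: U_def)
    also have "\<dots> = U n x" by (simp add: exp_minus_inverse mult.assoc flip: exp_add)
    finally show ?thesis .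
  qed
  define l where "l = exp (e\<^sup>2 / (4 * V))"
  have Umeas [measurable]: "(\<lambda>\<omega>. U k (path \<omega>)) \<in> borel_measurable M" for k
    by (rule path_function_measurable[OF depU])
  have "l \<le> U n x" if "e \<le> (\<Sum>k<n. W k x)" for n x
  proof -
    have "\<theta> * e - \<theta>\<^sup>2 * V = e\<^sup>2 / (4 * V)" using V(2) by (simp add: \<theta>_def field_simps power2_eq_square)
    moreover have "\<theta> * e \<le> \<theta> * (\<Sum>k<n. W k x)" using \<theta> that by simp
    moreover have "\<theta>\<^sup>2 * (\<Sum>k<n. (b k)\<^sup>2) \<le> \<theta>\<^sup>2 * V" using V(1) by (intro mult_left_mono) auto
    ultimately show ?thesis by (simp add: U_def l_def)
  qed
  then have "prob {\<omega> \<in> space M. \<exists>n. e \<le> (\<Sum>k<n. W k (path \<omega>))}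
      \<le> prob {\<omega> \<in> space M. \<exists>n. l \<le> U n (path \<omega>)}"
    by (intro finite_measure_mono) auto
  also have "\<dots> \<le> 1 / l"
    by (rule supermartingale_maximal_inequality[OF depU _ _ stepU]) (auto simp: U_def l_def)
  also have "\<dots> = exp (- e\<^sup>2 / (4 * V))" by (simp add: l_def exp_minus field_simps)
  finally show ?thesis .
qed

lemma azuma:
  fixes W :: "nat \<Rightarrow> (nat \<Rightarrow> 'x) \<Rightarrow> real"
  assumes dep: "\<And>k. depends_upto (Suc k) (W k)"
    and mean: "\<And>k x. (\<Sum>y\<in>UNIV. P (x k) y * W k (x(Suc k := y))) = 0"
    and bound: "\<And>k x. \<bar>W k x\<bar> \<le> b k"
    and V: "\<And>n. (\<Sum>k<n. (b k)\<^sup>2) \<le> V" "0 < V"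
    and e: "0 < e"
  shows "{\<omega> \<in> space M. \<exists>n. e \<le> \<bar>\<Sum>k<n. W k (path \<omega>)\<bar>} \<in> events"
    and "prob {\<omega> \<in> space M. \<exists>n. e \<le> \<bar>\<Sum>k<n. W k (path \<omega>)\<bar>} \<le> 2 * exp (- e\<^sup>2 / (4 * V))"
proof -
  let ?A = "{\<omega> \<in> space M. \<exists>n. e \<le> (\<Sum>k<n. W k (path \<omega>))}"
  let ?B = "{\<omega> \<in> space M. \<exists>n. e \<le> (\<Sum>k<n. - W k (path \<omega>))}"
  have [measurable]: "(\<lambda>\<omega>. W k (path \<omega>)) \<in> borel_measurable M" for k
    by (rule path_function_measurable[OF dep])
  show "{\<omega> \<in> space M. \<exists>n. e \<le> \<bar>\<Sum>k<n. W k (path \<omega>)\<bar>} \<in> events" by measurable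
  have 1: "prob ?A \<le> exp (- e\<^sup>2 / (4 * V))" by (rule azuma_one_sided[OF assms])
  have 2: "prob ?B \<le> exp (- e\<^sup>2 / (4 * V))"
    by (rule azuma_one_sided[of "\<lambda>k x. - W k x", OF _ _ _ V e])
      (use dep mean bound in \<open>auto simp: depends_upto_def sum_negf\<close>)
  have "{\<omega> \<in> space M. \<exists>n. e \<le> \<bar>\<Sum>k<n. W k (path \<omega>)\<bar>} = ?A \<union> ?B"
  proof -
    have "e \<le> \<bar>z\<bar> \<longleftrightarrow> e \<le> z \<or> e \<le> - z" for z :: real by linarith
    then show ?thesis by (auto simp: sum_negf)
  qed
  also have "prob (?A \<union> ?B) \<le> prob ?A + prob ?B"
    by (intro measure_Un_le) measurable
  finally show "prob {\<omega> \<in> space M. \<exists>n. e \<le> \<bar>\<Sum>k<n. W k (path \<omega>)\<bar>} \<le> 2 * exp (- e\<^sup>2 / (4 * V))"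
    using 1 2 by linarith
qed

end

section \<open>Drift functions and asynchronous contractions\<close>

text \<open>A Foster-Lyapunov function read off the transition graph: a bounded concave transform of
  the distance \<open>rank\<close> to \<open>y\<close>. Some transition of positive probability
  leads closer to \<open>y\<close>; for small \<open>\<epsilon>\<close> its contribution to the mean
  of \<open>\<epsilon> ^ rank\<close> alone exceeds the current value, however far the other
  transitions lead away.\<close>

lemma drift_function_exists:
  fixes P :: "'x::finite \<Rightarrow> 'x \<Rightarrow> real"
  assumes nonneg: "\<And>x z. 0 \<le> P x z"
    and sum: "\<And>x. (\<Sum>z\<in>UNIV. P x z) = 1"
    and reach: "\<And>x. (x, y) \<in> {(u, v). 0 < P u v}\<^sup>*"
  obtains h H where "0 < H" "h y = 0" "\<And>x. 0 \<le> h x" "\<And>x. h x \<le> H"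
    "\<And>x. x \<noteq> y \<Longrightarrow> (\<Sum>z\<in>UNIV. P x z * h z) \<le> h x - 1"
proof -
  let ?R = "{(u, v). 0 < P u v}"
  define rank where "rank x = (LEAST n. (x, y) \<in> ?R ^^ n)" for x
  define pm where "pm = Min ((\<lambda>(u, v). P u v) ` ?R)"
  have rank_in: "(x, y) \<in> ?R ^^ rank x" for x
  proof -
    from reach[of x] obtain n where "(x, y) \<in> ?R ^^ n" by (auto simp: rtrancl_power)
    then show ?thesis unfolding rank_def by (rule LeastI)
  qed
  have rank_le: "(x, y) \<in> ?R ^^ n \<Longrightarrow> rank x \<le> n" for x n
    unfolding rank_def by (rule Least_le)
  have "\<exists>z. 0 < P y z"
  proof (rule ccontr)
    assume "\<nexists>z. 0 < P y z"
    then have "P y z = 0" for z using nonneg[of y z] by (auto simp: not_less intro: antisym)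
    with sum[of y] show False by simp
  qed
  then have ne: "?R \<noteq> {}" by auto
  have pm_pos: "0 < pm"
    unfolding pm_def using ne by (subst Min_gr_iff) auto
  have pm_le: "pm \<le> P u v" if "0 < P u v" for u v
    unfolding pm_def using that by (intro Min_le) auto
  have P_le: "P u v \<le> 1" for u v
  proof -
    have "P u v \<le> (\<Sum>z\<in>UNIV. P u z)" by (rule member_le_sum) (auto simp: nonneg)
    then show ?thesis by (simp add: sum)
  qed
  have "pm \<le> 1" using \<open>\<exists>z. 0 < P y z\<close> pm_le P_le by (meson order_trans)
  \<comment> \<open>Half the least positive transition probability: one step closer to
    \<open>y\<close> then contributes at least
    \<open>pm * \<epsilon> ^ n = 2 * \<epsilon> ^ rank x\<close>, twice the current value.\<close>
  define \<epsilon> where "\<epsilon> = pm / 2"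
  have \<epsilon>: "0 < \<epsilon>" "\<epsilon> \<le> 1" using pm_pos \<open>pm \<le> 1\<close> by (auto simp: \<epsilon>_def)
  define N where "N = Max (range rank)"
  have rank_N: "rank x \<le> N" for x by (simp add: N_def)
  \<comment> \<open>Scales the decrease \<open>H * \<epsilon> ^ rank x\<close> to at least 1, even
    at the largest rank \<open>N\<close>.\<close>
  define H where "H = (1 / \<epsilon>) ^ N"
  define h where "h x = H * (1 - \<epsilon> ^ rank x)" for x
  have H: "0 < H" using \<epsilon> by (simp add: H_def)
  show ?thesis
  proof
    show "0 < H" by fact
    show "h y = 0" using rank_le[of y 0] by (simp add: h_def)
    show "0 \<le> h x" for x using H \<epsilon> by (simp add: h_def power_le_one)
    show "h x \<le> H" for x using H \<epsilon> by (simp add: h_def)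
    show "(\<Sum>z\<in>UNIV. P x z * h z) \<le> h x - 1" if xy: "x \<noteq> y" for x
    proof -
      obtain n where n: "rank x = Suc n"
        using rank_in[of x] xy by (cases "rank x") auto
      from rank_in[of x] obtain z where z: "0 < P x z" "(z, y) \<in> ?R ^^ n"
        unfolding n by (blast dest: relpow_Suc_D2)
      have "pm * \<epsilon> ^ n \<le> P x z * \<epsilon> ^ rank z"
        using pm_le[OF z(1)] rank_le[OF z(2)] \<epsilon> pm_pos
        by (intro mult_mono power_decreasing) auto
      also have "\<dots> \<le> (\<Sum>z\<in>UNIV. P x z * \<epsilon> ^ rank z)"
        by (rule member_le_sum[where f = "\<lambda>z. P x z * \<epsilon> ^ rank z"]) (use nonneg \<epsilon> in auto)
      finally have 1: "2 * \<epsilon> ^ rank x \<le> (\<Sum>z\<in>UNIV. P x z * \<epsilon> ^ rank z)"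
        by (simp add: n \<epsilon>_def)
      have "(\<Sum>z\<in>UNIV. P x z * h z) = H * (1 - (\<Sum>z\<in>UNIV. P x z * \<epsilon> ^ rank z))"
      proof -
        have "P x z * h z = H * P x z - H * (P x z * \<epsilon> ^ rank z)" for z
          by (simp add: h_def algebra_simps)
        then show ?thesis
          by (simp add: sum_subtractf sum_distrib_left[symmetric] sum right_diff_distrib)
      qed
      also have "\<dots> \<le> H * (1 - 2 * \<epsilon> ^ rank x)" using 1 H by simp
      also have "\<dots> = h x - H * \<epsilon> ^ rank x" by (simp add: h_def algebra_simps)
      also have "\<dots> \<le> h x - 1"
      proof -
        have "1 = H * \<epsilon> ^ N" using \<epsilon> by (simp add: H_def power_one_over)
        also have "\<dots> \<le> H * \<epsilon> ^ rank x"
          using H \<epsilon> rank_N by (intro mult_left_mono power_decreasing) auto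
        finally show ?thesis by simp
      qed
      finally show ?thesis .
    qed
  qed
qed

text \<open>After the noise \<open>Z t x / g t\<close> is subtracted, the error at \<open>x\<close> is dominated by
  \<open>b t x = (B * g m / g t) * exp (- l * D t x)\<close>.  The weight \<open>exp (- l * D t x)\<close>
  decreases at the visits to \<open>x\<close> and increases slightly in between; since \<open>D\<close> stays bounded,
  the frequencies of the visits balance and the weights remain comparable.\<close>

lemma asynchronous_contraction_decay:
  fixes e Z D :: "nat \<Rightarrow> 'x::finite \<Rightarrow> real" and Y :: "nat \<Rightarrow> 'x"
    and \<alpha> g F w :: "nat \<Rightarrow> real"
  assumes gam: "0 \<le> \<gamma>" "\<gamma> < 1" and d: "0 < d" "d \<le> 1"
    and l: "l = (1 - \<gamma>) / 4" and c: "c = (1 - \<gamma>) * d / 8"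
    and \<alpha>: "\<And>t. m \<le> t \<Longrightarrow> 0 \<le> \<alpha> t" "\<And>t. m \<le> t \<Longrightarrow> \<alpha> t \<le> 1"
    and g_pos: "\<And>t. m \<le> t \<Longrightarrow> 0 < g t"
    and g_mono: "\<And>t. m \<le> t \<Longrightarrow> g t \<le> g (Suc t)"
    and g_growth: "\<And>t. m \<le> t \<Longrightarrow> g (Suc t) \<le> exp (c * \<alpha> t) * g t"
    and e_step: "\<And>t x. m \<le> t \<Longrightarrow> e (Suc t) x =
      (if x = Y t then (1 - \<alpha> t) * e t x + \<alpha> t * (F t + w t) else e t x)"
    and F: "\<And>t E. m \<le> t \<Longrightarrow> (\<And>x. \<bar>e t x\<bar> \<le> E) \<Longrightarrow> \<bar>F t\<bar> \<le> \<gamma> * E"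
    and Z_0: "\<And>x. Z m x = 0"
    and Z_step: "\<And>t x. m \<le> t \<Longrightarrow> Z (Suc t) x = Z t x + (if x = Y t then g (Suc t) * \<alpha> t * w t else 0)"
    and Z_bound: "\<And>t x. m \<le> t \<Longrightarrow> \<bar>Z t x\<bar> \<le> (1 - \<gamma>) / 16 * B * g m"
    and D_0: "\<And>x. D m x = 0"
    and D_step: "\<And>t x. m \<le> t \<Longrightarrow> D (Suc t) x - D t x \<le> \<alpha> t * ((if x = Y t then 1 else 0) - d)"
    and D_bound: "\<And>t x. m \<le> t \<Longrightarrow> \<bar>D t x\<bar> \<le> 1 / 4"
    and B: "0 < B" "\<And>x. \<bar>e m x\<bar> \<le> B"
    and t: "m \<le> t"
  shows "\<bar>e t x\<bar> \<le> 3 * B * g m / g t"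
proof -
  define b where "b t x = B * g m / g t * exp (- (l * D t x))" for t x
  define \<epsilon> where "\<epsilon> = (1 - \<gamma>) / 16 * B * g m"
  have l_bounds: "0 < l" "l \<le> 1 / 4" using gam by (auto simp: l)
  have "(1 - \<gamma>) * d \<le> 1 * 1" using gam d by (intro mult_mono) auto
  then have c_bounds: "0 < c" "c \<le> 1" using gam d by (auto simp: c)
  have gm: "0 < g m" using g_pos by simp
  have exp_half: "1 / 2 \<le> exp (- (l * D t x))" "exp (- (l * D t x)) \<le> 2" if "m \<le> t" for t x
  proof -
    have "\<bar>l * D t x\<bar> \<le> 1 * (1/4)" unfolding abs_mult
      using D_bound[OF that] l_bounds by (intro mult_mono) auto
    then have *: "- (1/4) \<le> - (l * D t x)" "- (l * D t x) \<le> 1/4" by linarith+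
    show "1 / 2 \<le> exp (- (l * D t x))"
      using exp_ge_add_one_self[of "- (l * D t x)"] * by linarith
    have "exp (- (l * D t x)) \<le> exp (1/4)" using * by simp
    also have "\<dots> \<le> 1 + 1/4 + (1/4)\<^sup>2" by (rule exp_bound) auto
    finally show "exp (- (l * D t x)) \<le> 2" by (simp add: power2_eq_square)
  qed
  \<comment> \<open>The noise tolerance \<open>(1 - \<gamma>) / 16\<close> becomes
    \<open>(1 - \<gamma>) / 8\<close>, that is \<open>l / 2\<close>, relative to the envelope,
    because the weights are at least 1/2.\<close>
  have b_lower: "\<epsilon> / g t \<le> (1 - \<gamma>) / 8 * b t x" if "m \<le> t" for t x
  proof -
    have "\<epsilon> / g t = (1 - \<gamma>) / 8 * (B * g m / g t) * (1 / 2)" by (simp add: \<epsilon>_def)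
    also have "\<dots> \<le> (1 - \<gamma>) / 8 * (B * g m / g t) * exp (- (l * D t x))"
      using gam B gm g_pos[OF that] by (intro mult_left_mono exp_half that) auto
    finally show ?thesis by (simp add: b_def)
  qed
  have b_pos: "0 < b t x" if "m \<le> t" for t x
    using B gm g_pos[OF that] by (simp add: b_def)
  \<comment> \<open>Two values of \<open>D\<close> differ by at most 1/2, so the envelopes of two
    pairs differ by at most the factor \<open>exp (l / 2) \<le> 1 + l\<close>.\<close>
  have b_compare: "b t y \<le> (1 + l) * b t x" if "m \<le> t" for t x y
  proof -
    have "- (l * D t y) \<le> l / 2 + - (l * D t x)"
    proof -
      have "l * (D t x - D t y) \<le> l * (1/2)"
        using D_bound[OF that, of x] D_bound[OF that, of y] l_bounds by (intro mult_left_mono) auto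
      then show ?thesis by (simp add: algebra_simps)
    qed
    then have "exp (- (l * D t y)) \<le> exp (l / 2) * exp (- (l * D t x))"
      by (simp flip: exp_add)
    also have "exp (l / 2) \<le> 1 + l / 2 + (l / 2)\<^sup>2" using l_bounds by (intro exp_bound) auto
    also have "(l / 2)\<^sup>2 \<le> l / 2"
      using l_bounds mult_left_mono[of "l/2" 1 "l/2"] by (simp add: power2_eq_square)
    also have "1 + l / 2 + l / 2 = 1 + l" by simp
    finally have "exp (- (l * D t y)) \<le> (1 + l) * exp (- (l * D t x))" by simp
    then have "B * g m / g t * exp (- (l * D t y)) \<le> B * g m / g t * ((1 + l) * exp (- (l * D t x)))"
      using B gm g_pos[OF that] by (intro mult_left_mono) auto
    then show ?thesis by (simp add: b_def mult_ac)
  qed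
  \<comment> \<open>The growth of \<open>g\<close> costs \<open>c * \<alpha> t\<close> in the
    exponent, while the term \<open>d\<close> in \<open>D_step\<close> earns
    \<open>l * d * \<alpha> t = 2 * c * \<alpha> t\<close>. So the envelope of an unvisited pair
    rises at rate at least \<open>c\<close>, and that of the visited one falls at rate at most
    \<open>l - c\<close>.\<close>
  have b_step: "b t x * (1 + \<alpha> t * (c - l * (if x = Y t then 1 else 0))) \<le> b (Suc t) x" if "m \<le> t" for t x
  proof -
    let ?i = "if x = Y t then 1 else 0 :: real"
    have gt: "0 < g t" "0 < g (Suc t)" using g_pos that by auto
    have ld: "l * d = 2 * c" by (simp add: l c)
    have "1 + \<alpha> t * (c - l * ?i) \<le> exp (\<alpha> t * (c - l * ?i))" by (rule exp_ge_add_one_self)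
    also have "\<dots> \<le> exp (- (c * \<alpha> t)) * exp (- (l * (D (Suc t) x - D t x)))"
    proof -
      have "l * (D (Suc t) x - D t x) \<le> l * (\<alpha> t * (?i - d))"
        using l_bounds D_step[OF that] by (intro mult_left_mono) auto
      also have "\<dots> = \<alpha> t * (l * ?i) - \<alpha> t * (l * d)" by (simp add: algebra_simps)
      also have "\<dots> = \<alpha> t * (l * ?i) - \<alpha> t * (2 * c)" by (simp only: ld)
      finally have "\<alpha> t * (c - l * ?i) \<le> - (c * \<alpha> t) + - (l * (D (Suc t) x - D t x))"
        by (simp add: algebra_simps)
      then show ?thesis by (simp only: exp_add[symmetric] exp_le_cancel_iff)
    qed
    also have "exp (- (c * \<alpha> t)) \<le> g t / g (Suc t)"
      using g_growth[OF that] gt by (simp add: exp_minus field_simps)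
    finally have "1 + \<alpha> t * (c - l * ?i) \<le> g t / g (Suc t) * exp (- (l * (D (Suc t) x - D t x)))"
      by simp
    then have "b t x * (1 + \<alpha> t * (c - l * ?i)) \<le> b t x * (g t / g (Suc t) * exp (- (l * (D (Suc t) x - D t x))))"
      using b_pos[OF that, of x] by (intro mult_left_mono) auto
    also have "\<dots> = b (Suc t) x"
    proof -
      have "exp (- (l * D t x)) * exp (- (l * (D (Suc t) x - D t x))) = exp (- (l * D (Suc t) x))"
        by (simp add: algebra_simps flip: exp_add)
      then show ?thesis using gt unfolding b_def by (simp add: field_simps)
    qed
    finally show ?thesis .
  qed
  have main: "\<bar>e t x - Z t x / g t\<bar> \<le> b t x" if "m \<le> t" for t x
    using that
  proof (induction t arbitrary: x rule: dec_induct)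
    case base
    then show ?case using gm B by (simp add: Z_0 b_def D_0)
  next
    case (step t)
    note mt = \<open>m \<le> t\<close>
    let ?G = "g t" and ?G' = "g (Suc t)" and ?a = "\<alpha> t"
    have gt: "0 < ?G" "0 < ?G'" using g_pos mt by auto
    have a: "0 \<le> ?a" "?a \<le> 1" using \<alpha> mt by auto
    have inv1: "1 / ?G' \<le> 1 / ?G" using g_mono[OF mt] gt by (simp add: field_simps)
    have inv2: "(1 - c * ?a) / ?G \<le> 1 / ?G'"
    proof -
      have "1 - c * ?a \<le> exp (- (c * ?a))" using exp_ge_add_one_self[of "- (c * ?a)"] by simp
      also have "\<dots> \<le> ?G / ?G'" using g_growth[OF mt] gt by (simp add: exp_minus field_simps)
      finally show ?thesis using gt by (simp add: field_simps)
    qed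
    have zb: "\<bar>Z t x\<bar> \<le> \<epsilon>" for x using Z_bound[OF mt] by (simp add: \<epsilon>_def)
    have \<epsilon>G: "0 \<le> \<epsilon> / ?G" using gam B gm gt by (simp add: \<epsilon>_def)
    have bx: "0 < b t x" by (rule b_pos[OF mt])
    show ?case
    proof (cases "x = Y t")
      \<comment> \<open>The error stands still; only the division of \<open>Z\<close> by the larger
        \<open>g (Suc t)\<close> changes the difference, by at most \<open>c * \<alpha> t\<close>
        times the tolerance, and the rise of the envelope covers this.\<close>
      case False
      have "e (Suc t) x - Z (Suc t) x / ?G' = (e t x - Z t x / ?G) + Z t x * (1 / ?G - 1 / ?G')"
        using False by (simp add: e_step[OF mt] Z_step[OF mt] algebra_simps)
      also have "\<bar>\<dots>\<bar> \<le> \<bar>e t x - Z t x / ?G\<bar> + \<bar>Z t x * (1 / ?G - 1 / ?G')\<bar>" by (rule abs_triangle_ineq)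
      also have "\<dots> \<le> b t x + \<epsilon> * (c * ?a / ?G)"
      proof (rule add_mono[OF step.IH])
        have "1 / ?G - 1 / ?G' \<le> c * ?a / ?G" using inv2 by (simp add: diff_divide_distrib)
        then show "\<bar>Z t x * (1 / ?G - 1 / ?G')\<bar> \<le> \<epsilon> * (c * ?a / ?G)"
          unfolding abs_mult using inv1 zb[of x] by (intro mult_mono) auto
      qed
      also have "\<epsilon> * (c * ?a / ?G) = (c * ?a) * (\<epsilon> / ?G)" by simp
      also have "\<dots> \<le> (c * ?a) * b t x"
      proof (intro mult_left_mono)
        have "(1 - \<gamma>) / 8 * b t x \<le> 1 * b t x" using gam bx by (intro mult_right_mono) auto
        with b_lower[OF mt, of x] show "\<epsilon> / ?G \<le> b t x" by linarith
      qed (use a c_bounds in auto)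
      also have "b t x + c * ?a * b t x = b t x * (1 + ?a * (c - l * (if x = Y t then 1 else 0)))"
        using False by (simp add: algebra_simps)
      also have "\<dots> \<le> b (Suc t) x" by (rule b_step[OF mt])
      finally show ?thesis by simp
    next
      case True
      let ?E = "(1 + l) * b t x + \<epsilon> / ?G"
      have Eb: "\<bar>e t y\<bar> \<le> ?E" for y
      proof -
        have "\<bar>e t y\<bar> \<le> \<bar>e t y - Z t y / ?G\<bar> + \<bar>Z t y / ?G\<bar>" by linarith
        also have "\<dots> \<le> (1 + l) * b t x + \<epsilon> / ?G"
          using step.IH[of y] b_compare[OF mt, of y x] zb[of y] gt
          by (intro add_mono) (auto simp: abs_divide divide_right_mono)
        finally show ?thesis .
      qed
      have Fb: "\<bar>F t\<bar> \<le> \<gamma> * ?E" by (rule F[OF mt Eb])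
      \<comment> \<open>The new summand of \<open>Z\<close> carries the weight
        \<open>g (Suc t)\<close>, so the division by \<open>g (Suc t)\<close> removes the noise
        \<open>\<alpha> t * w t\<close> exactly; what is left is the rescaling of the old
        \<open>Z\<close>.\<close>
      have "e (Suc t) x - Z (Suc t) x / ?G'
          = (1 - ?a) * (e t x - Z t x / ?G) + ?a * F t + Z t x * ((1 - ?a) / ?G - 1 / ?G')"
        using True gt by (simp add: e_step[OF mt] Z_step[OF mt] field_simps)
      then have "\<bar>e (Suc t) x - Z (Suc t) x / ?G'\<bar>
          \<le> \<bar>(1 - ?a) * (e t x - Z t x / ?G)\<bar> + \<bar>?a * F t\<bar> + \<bar>Z t x * ((1 - ?a) / ?G - 1 / ?G')\<bar>"
        by linarith
      also have "\<dots> \<le> (1 - ?a) * b t x + ?a * (\<gamma> * ?E) + \<epsilon> * (?a / ?G)"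
      proof (intro add_mono)
        show "\<bar>(1 - ?a) * (e t x - Z t x / ?G)\<bar> \<le> (1 - ?a) * b t x"
          using a step.IH[of x] by (simp add: abs_mult mult_left_mono)
        show "\<bar>?a * F t\<bar> \<le> ?a * (\<gamma> * ?E)" using a Fb by (simp add: abs_mult mult_left_mono)
        have "(1 - ?a) / ?G \<le> (1 - c * ?a) / ?G"
          using gt a c_bounds by (intro divide_right_mono) (auto simp: mult_left_le_one_le)
        with inv2 have "(1 - ?a) / ?G - 1 / ?G' \<le> 0" by linarith
        moreover have "1 / ?G' - (1 - ?a) / ?G \<le> ?a / ?G" using inv1 by (simp add: diff_divide_distrib)
        ultimately have "\<bar>(1 - ?a) / ?G - 1 / ?G'\<bar> \<le> ?a / ?G" by linarith
        then show "\<bar>Z t x * ((1 - ?a) / ?G - 1 / ?G')\<bar> \<le> \<epsilon> * (?a / ?G)"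
          unfolding abs_mult using zb[of x] by (intro mult_mono) auto
      qed
      \<comment> \<open>The budget: contraction \<open>\<gamma>\<close>, comparison of pairs at most
        \<open>l\<close>, and two noise terms of at most \<open>l / 2\<close> each add up to
        \<open>\<gamma> + 2 * l\<close>. As \<open>\<gamma> = 1 - 4 * l\<close>, this is below
        \<open>1 - l\<close>, so the visited error follows the falling envelope.\<close>
      also have "\<dots> \<le> b t x * (1 - ?a * l)"
      proof -
        have "\<gamma> * (\<epsilon> / ?G) \<le> \<epsilon> / ?G" using mult_left_le_one_le[OF \<epsilon>G gam(1)] gam by simp
        moreover have "\<gamma> * ((1 + l) * b t x) \<le> (\<gamma> + l) * b t x"
        proof -
          have "\<gamma> * l \<le> l" using l_bounds gam by (simp add: mult_left_le_one_le)
          then have "(\<gamma> * (1 + l)) * b t x \<le> (\<gamma> + l) * b t x"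
            using bx by (intro mult_right_mono) (auto simp: algebra_simps)
          then show ?thesis by simp
        qed
        moreover have "\<epsilon> / ?G \<le> l / 2 * b t x" using b_lower[OF mt, of x] by (simp add: l)
        ultimately have "\<gamma> * ?E + \<epsilon> / ?G \<le> (\<gamma> + l) * b t x + 2 * (l / 2 * b t x)"
          unfolding distrib_left by linarith
        also have "\<dots> = (\<gamma> + 2 * l) * b t x" by (simp add: algebra_simps)
        also have "\<dots> \<le> (1 - l) * b t x"
          using bx gam by (intro mult_right_mono) (auto simp: l field_simps)
        finally have "?a * (\<gamma> * ?E + \<epsilon> / ?G) \<le> ?a * ((1 - l) * b t x)" using a by (intro mult_left_mono)
        then show ?thesis by (simp add: algebra_simps)
      qed
      also have "\<dots> \<le> b t x * (1 + ?a * (c - l * (if x = Y t then 1 else 0)))"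
        using bx True a c_bounds by (intro mult_left_mono) (auto simp: algebra_simps)
      also have "\<dots> \<le> b (Suc t) x" by (rule b_step[OF mt])
      finally show ?thesis .
    qed
  qed
  have gt: "0 < g t" using g_pos t by simp
  have "\<bar>e t x\<bar> \<le> \<bar>e t x - Z t x / g t\<bar> + \<bar>Z t x / g t\<bar>" by linarith
  also have "\<dots> \<le> B * g m / g t * 2 + 1 * B * g m / g t"
  proof (intro add_mono)
    have "b t x \<le> B * g m / g t * 2"
      unfolding b_def using B gm gt by (intro mult_left_mono exp_half t) auto
    with main[OF t, of x] show "\<bar>e t x - Z t x / g t\<bar> \<le> B * g m / g t * 2" by linarith
    have "(1 - \<gamma>) / 16 * B * g m \<le> 1 * B * g m" using gam B gm by (intro mult_right_mono) auto
    with Z_bound[OF t, of x] have "\<bar>Z t x\<bar> \<le> 1 * B * g m" by linarith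
    then show "\<bar>Z t x / g t\<bar> \<le> 1 * B * g m / g t" using gt by (simp add: abs_divide divide_right_mono)
  qed
  also have "\<dots> = 3 * B * g m / g t" by simp
  finally show ?thesis .
qed

section \<open>The Q-learning recursion\<close>

text \<open>Summation by parts with decreasing weights: boundary terms and weight differences
  together never exceed \<open>\<alpha> m * H\<close>, however large \<open>t\<close> is. This makes
  the telescoping part of the process \<open>D\<close> as small as one late step size.\<close>

lemma abel_sum_bound:
  fixes \<alpha> h :: "nat \<Rightarrow> real"
  assumes \<alpha>: "\<And>t. 0 \<le> \<alpha> t" "\<And>t. \<alpha> (Suc t) \<le> \<alpha> t"
    and h: "\<And>t. 0 \<le> h t" "\<And>t. h t \<le> H"
    and t: "m \<le> t"
  shows "\<bar>\<Sum>k<t. if m \<le> k then \<alpha> k * (h (Suc k) - h k) else 0\<bar> \<le> \<alpha> m * H"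
proof -
  let ?S = "\<lambda>t. \<Sum>k<t. if m \<le> k then \<alpha> k * (h (Suc k) - h k) else 0"
  have "\<alpha> t * h t - \<alpha> m * h m \<le> ?S t \<and> ?S t \<le> \<alpha> t * h t + (\<alpha> m - \<alpha> t) * H - \<alpha> m * h m"
    using t
  proof (induction t rule: dec_induct)
    case base
    have "?S m = 0" by (intro sum.neutral) auto
    then show ?case by simp
  next
    case (step n)
    have S: "?S (Suc n) = ?S n + (\<alpha> n * h (Suc n) - \<alpha> n * h n)" using step.hyps by (simp add: algebra_simps)
    have "0 \<le> (\<alpha> n - \<alpha> (Suc n)) * h (Suc n)" using \<alpha> h by simp
    moreover have "(\<alpha> n - \<alpha> (Suc n)) * h (Suc n) \<le> (\<alpha> n - \<alpha> (Suc n)) * H"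
      using \<alpha> h by (intro mult_left_mono) auto
    ultimately show ?case using step.IH unfolding S left_diff_distrib by linarith
  qed
  moreover have "0 \<le> \<alpha> t * h t" "0 \<le> \<alpha> m * h m" "\<alpha> m * h m \<le> \<alpha> m * H" "\<alpha> t * h t \<le> \<alpha> t * H"
    using \<alpha> h by (auto intro: mult_left_mono)
  ultimately show ?thesis unfolding left_diff_distrib by linarith
qed

lemma Max_range_diff_le:
  fixes f g :: "'a::finite \<Rightarrow> real"
  assumes "\<And>a. \<bar>f a - g a\<bar> \<le> E"
  shows "\<bar>Max (range f) - Max (range g)\<bar> \<le> E"
proof -
  have "Max (range f) \<le> Max (range g) + E" if *: "\<And>a. \<bar>f a - g a\<bar> \<le> E" for f g :: "'a \<Rightarrow> real"
  proof (rule Max.boundedI)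
    fix y assume "y \<in> range f"
    then obtain a where a: "y = f a" by auto
    have "g a \<le> Max (range g)" by simp
    with *[of a] show "y \<le> Max (range g) + E" unfolding a by linarith
  qed auto
  from this[of f g, OF assms] this[of g f] assms
  have "Max (range f) \<le> Max (range g) + E" "Max (range g) \<le> Max (range f) + E"
    by (simp_all only: abs_minus_commute)
  then show ?thesis by linarith
qed

lemma abs_Max_range_le:
  fixes f :: "'a::finite \<Rightarrow> real"
  assumes "\<And>a. \<bar>f a\<bar> \<le> E"
  shows "\<bar>Max (range f)\<bar> \<le> E"
  using Max_range_diff_le[of f "\<lambda>_. 0" E] assms by simp

locale q_learning = prob_space M for M :: "'w measure" +
  fixes S :: "nat \<Rightarrow> 'w \<Rightarrow> 's::finite"
    and A :: "nat \<Rightarrow> 'w \<Rightarrow> 'a::finite"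
    and r :: "'s \<Rightarrow> 'a \<Rightarrow> real"
    and p :: "'s \<Rightarrow> 'a \<Rightarrow> 's \<Rightarrow> real"
    and p0 :: "'s \<Rightarrow> real"
    and mu :: "'s \<Rightarrow> 'a \<Rightarrow> real"
    and \<gamma> :: real
    and q0 qstar :: "'s \<Rightarrow> 'a \<Rightarrow> real"
  assumes S_measurable [measurable]: "\<And>t. S t \<in> measurable M (count_space UNIV)"
    and A_measurable [measurable]: "\<And>t. A t \<in> measurable M (count_space UNIV)"
    and p_nonneg: "\<And>s a s'. p s a s' \<ge> 0"
    and p_sum: "\<And>s a. (\<Sum>s'\<in>UNIV. p s a s') = 1"
    and mu_nonneg: "\<And>s a. mu s a \<ge> 0"
    and mu_sum: "\<And>s. (\<Sum>a\<in>UNIV. mu s a) = 1"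
    and gamma: "0 \<le> \<gamma>" "\<gamma> < 1"
    and law: "\<And>n (s :: nat \<Rightarrow> 's) (a :: nat \<Rightarrow> 'a).
       measure M {\<omega> \<in> space M. \<forall>k\<le>n. S k \<omega> = s k \<and> A k \<omega> = a k}
       = p0 (s 0) * mu (s 0) (a 0)
         * (\<Prod>k<n. p (s k) (a k) (s (Suc k)) * mu (s (Suc k)) (a (Suc k)))"
    and irred: "chain_irreducible mu p (triple_space p)"
    and qstar: "bellman r \<gamma> p qstar = qstar"
begin

text \<open>Pairs \<open>(S t, A t)\<close> suffice as states of the chain: the update at time
  \<open>t\<close> uses the current pair and the next state, which is the first component of the
  next pair. The noise is thus a function of one transition.\<close>

definition pair_kernel :: "'s \<times> 'a \<Rightarrow> 's \<times> 'a \<Rightarrow> real" where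
  "pair_kernel x y = p (fst x) (snd x) (fst y) * mu (fst y) (snd y)"

lemma sum_pair_kernel: "(\<Sum>y\<in>UNIV. pair_kernel x y * f (fst y)) = (\<Sum>s\<in>UNIV. p (fst x) (snd x) s * f s)"
proof -
  have "(\<Sum>y\<in>UNIV. pair_kernel x y * f (fst y))
      = (\<Sum>s\<in>UNIV. \<Sum>a\<in>UNIV. p (fst x) (snd x) s * mu s a * f s)"
    unfolding sum.cartesian_product pair_kernel_def UNIV_Times_UNIV by (intro sum.cong refl) auto
  also have "\<dots> = (\<Sum>s\<in>UNIV. p (fst x) (snd x) s * f s * (\<Sum>a\<in>UNIV. mu s a))"
    unfolding sum_distrib_left by (intro sum.cong refl) (simp add: mult_ac)
  finally show ?thesis by (simp add: mu_sum)
qed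

sublocale finite_chain M "\<lambda>t \<omega>. (S t \<omega>, A t \<omega>)" "\<lambda>x. p0 (fst x) * mu (fst x) (snd x)" pair_kernel
proof
  show "(\<lambda>\<omega>. (S t \<omega>, A t \<omega>)) \<in> measurable M (count_space UNIV)" for t
  proof -
    have "(\<lambda>\<omega>. (S t \<omega>, A t \<omega>)) \<in> measurable M (count_space UNIV \<Otimes>\<^sub>M count_space UNIV)"
      by (intro measurable_Pair) measurable
    also have "count_space UNIV \<Otimes>\<^sub>M count_space UNIV = (count_space UNIV :: ('s \<times> 'a) measure)"
      by (subst pair_measure_countable) auto
    finally show ?thesis .
  qed
  show "0 \<le> pair_kernel x y" for x y by (simp add: pair_kernel_def p_nonneg mu_nonneg)
  show "(\<Sum>y\<in>UNIV. pair_kernel x y) = 1" for x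
    using sum_pair_kernel[of x "\<lambda>_. 1"] by (simp add: p_sum)
  show "prob {\<omega> \<in> space M. \<forall>k\<le>n. (S k \<omega>, A k \<omega>) = x k}
      = p0 (fst (x 0)) * mu (fst (x 0)) (snd (x 0)) * (\<Prod>k<n. pair_kernel (x k) (x (Suc k)))" for n x
    using law[of n "\<lambda>k. fst (x k)" "\<lambda>k. snd (x k)"] by (simp add: pair_kernel_def prod_eq_iff)
qed

section \<open>Irreducibility passes from triples to pairs\<close>

lemma Kmat_nonneg: "0 \<le> Kmat mu p x y"
  by (simp add: Kmat_def p_nonneg mu_nonneg)

lemma Kpow_nonneg: "0 \<le> Kpow mu p n x y"
  by (induction n arbitrary: y) (auto intro!: sum_nonneg mult_nonneg_nonneg Kmat_nonneg)

text \<open>\<open>Kmat\<close> charges only the action and the successor of the new triple, so a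
  transition of pairs combines one factor from each of two consecutive triples. Membership in
  \<open>triple_space p\<close> is carried along because it supplies the factor of the earlier
  one.\<close>

lemma Kpow_pos_reaches:
  assumes "0 < Kpow mu p n x y" and "x \<in> triple_space p"
  shows "y \<in> triple_space p \<and>
    ((fst x, fst (snd x)), (fst y, fst (snd y))) \<in> {(u, v). 0 < pair_kernel u v}\<^sup>*"
  using assms
proof (induction n arbitrary: y)
  case 0
  then show ?case by (auto split: if_splits)
next
  case (Suc n)
  have "\<exists>z. Kpow mu p n x z * Kmat mu p z y \<noteq> 0"
  proof (rule ccontr)
    assume "\<nexists>z. Kpow mu p n x z * Kmat mu p z y \<noteq> 0"
    then have "Kpow mu p n x z * Kmat mu p z y = 0" for z by blast
    then have "Kpow mu p (Suc n) x y = 0" by (simp only: Kpow.simps sum.neutral_const)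
    with Suc.prems show False by linarith
  qed
  then obtain z where z: "Kpow mu p n x z \<noteq> 0" "Kmat mu p z y \<noteq> 0" by auto
  then have pos: "0 < Kpow mu p n x z" "0 < Kmat mu p z y"
    using Kpow_nonneg Kmat_nonneg by (simp_all add: order_less_le)
  obtain z1 z2 z3 y1 y2 y3 where zy: "z = (z1, z2, z3)" "y = (y1, y2, y3)"
    by (cases z, cases y) blast
  from Suc.IH[OF pos(1) Suc.prems(2)]
  have IH: "0 < p z1 z2 z3" "((fst x, fst (snd x)), (z1, z2)) \<in> {(u, v). 0 < pair_kernel u v}\<^sup>*"
    by (auto simp: zy triple_space_def)
  from pos(2) have y: "y1 = z3" "0 < mu y1 y2 * p y1 y2 y3"
    by (auto simp: Kmat_def zy split: if_splits)
  then have "0 < mu y1 y2" "0 < p y1 y2 y3"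
    using mu_nonneg[of y1 y2] p_nonneg[of y1 y2 y3] by (auto simp: zero_less_mult_iff)
  with IH y have "((z1, z2), (y1, y2)) \<in> {(u, v). 0 < pair_kernel u v}"
    by (simp add: pair_kernel_def)
  with IH(2) \<open>0 < p y1 y2 y3\<close> show ?case by (auto simp: zy triple_space_def intro: rtrancl.rtrancl_into_rtrancl)
qed

text \<open>Each row of \<open>p\<close> has a positive entry, so every pair extends to a triple in
  the space on which irreducibility is assumed.\<close>

lemma pair_kernel_reaches: "(x, y) \<in> {(u, v). 0 < pair_kernel u v}\<^sup>*"
proof -
  have "\<exists>s'. 0 < p s a s'" for s a
  proof (rule ccontr)
    assume "\<nexists>s'. 0 < p s a s'"
    then have "p s a s' = 0" for s' using p_nonneg[of s a s'] by (auto simp: not_less intro: antisym)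
    with p_sum[of s a] show False by simp
  qed
  then obtain x' y' where "0 < p (fst x) (snd x) x'" "0 < p (fst y) (snd y) y'" by meson
  then have in_space: "(fst x, snd x, x') \<in> triple_space p" "(fst y, snd y, y') \<in> triple_space p"
    by (auto simp: triple_space_def)
  then obtain n where "0 < Kpow mu p n (fst x, snd x, x') (fst y, snd y, y')"
    using irred unfolding chain_irreducible_def by blast
  from Kpow_pos_reaches[OF this in_space(1)] show ?thesis by simp
qed

section \<open>Iterates as functionals of the path: drift, noise and a uniform bound\<close>

definition iterate :: "(nat \<Rightarrow> real) \<Rightarrow> (nat \<Rightarrow> 's \<times> 'a) \<Rightarrow> nat \<Rightarrow> 's \<Rightarrow> 'a \<Rightarrow> real" where
  "iterate \<alpha> x t = qlearn r \<gamma> \<alpha> q0 (\<lambda>k. fst (x k)) (\<lambda>k. snd (x k)) t"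

definition err :: "(nat \<Rightarrow> real) \<Rightarrow> (nat \<Rightarrow> 's \<times> 'a) \<Rightarrow> nat \<Rightarrow> 's \<times> 'a \<Rightarrow> real" where
  "err \<alpha> x t y = iterate \<alpha> x t (fst y) (snd y) - qstar (fst y) (snd y)"

definition greedy :: "(nat \<Rightarrow> real) \<Rightarrow> (nat \<Rightarrow> 's \<times> 'a) \<Rightarrow> nat \<Rightarrow> 's \<Rightarrow> real" where
  "greedy \<alpha> x t s = Max (range (iterate \<alpha> x t s))"

text \<open>The value at \<open>x t\<close> of the Bellman operator applied to the current iterate,
  minus \<open>qstar\<close>; the rewards cancel by the fixed point equation.\<close>

definition drift :: "(nat \<Rightarrow> real) \<Rightarrow> (nat \<Rightarrow> 's \<times> 'a) \<Rightarrow> nat \<Rightarrow> real" where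
  "drift \<alpha> x t = \<gamma> * (\<Sum>s\<in>UNIV. p (fst (x t)) (snd (x t)) s * (greedy \<alpha> x t s - Max (range (qstar s))))"

definition noise :: "(nat \<Rightarrow> real) \<Rightarrow> (nat \<Rightarrow> 's \<times> 'a) \<Rightarrow> nat \<Rightarrow> real" where
  "noise \<alpha> x t = \<gamma> * (greedy \<alpha> x t (fst (x (Suc t)))
     - (\<Sum>s\<in>UNIV. p (fst (x t)) (snd (x t)) s * greedy \<alpha> x t s))"

lemma iterate_Suc:
  "iterate \<alpha> x (Suc t) s a = (if (s, a) = x t
     then iterate \<alpha> x t s a + \<alpha> t * (r s a + \<gamma> * greedy \<alpha> x t (fst (x (Suc t))) - iterate \<alpha> x t s a)
     else iterate \<alpha> x t s a)"
  by (auto simp: iterate_def greedy_def Let_def prod_eq_iff)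

lemma iterate_depends_upto: "depends_upto t (\<lambda>x. iterate \<alpha> x t)"
proof (induction t)
  case 0
  show ?case by (simp add: depends_upto_def iterate_def)
next
  case (Suc t)
  show ?case unfolding depends_upto_def
  proof (intro allI impI ext)
    fix x y :: "nat \<Rightarrow> 's \<times> 'a" and s a
    assume *: "\<forall>k\<le>Suc t. x k = y k"
    then have "iterate \<alpha> x t = iterate \<alpha> y t" by (intro depends_uptoD[OF Suc]) auto
    moreover have "x t = y t" "x (Suc t) = y (Suc t)" using * by auto
    ultimately show "iterate \<alpha> x (Suc t) s a = iterate \<alpha> y (Suc t) s a"
      by (simp add: iterate_Suc greedy_def)
  qed
qed

lemma err_depends_upto: "depends_upto t (\<lambda>x. err \<alpha> x t y)"
  using iterate_depends_upto[of t \<alpha>] unfolding depends_upto_def err_def by metis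

text \<open>The index is \<open>Suc t\<close> because the noise at time \<open>t\<close> is revealed
  only by the next state; this is the form that \<open>azuma\<close> expects.\<close>

lemma noise_depends_upto: "depends_upto (Suc t) (\<lambda>x. noise \<alpha> x t)"
  unfolding depends_upto_def
proof (intro allI impI)
  fix x y :: "nat \<Rightarrow> 's \<times> 'a" assume *: "\<forall>k\<le>Suc t. x k = y k"
  then have "iterate \<alpha> x t = iterate \<alpha> y t" by (intro depends_uptoD[OF iterate_depends_upto]) auto
  then show "noise \<alpha> x t = noise \<alpha> y t" using * by (simp add: noise_def greedy_def)
qed

lemma noise_mean_zero: "(\<Sum>y\<in>UNIV. pair_kernel (x t) y * noise \<alpha> (x(Suc t := y)) t) = 0"
proof -
  let ?c = "\<Sum>s\<in>UNIV. p (fst (x t)) (snd (x t)) s * greedy \<alpha> x t s"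
  have "iterate \<alpha> (x(Suc t := y)) t = iterate \<alpha> x t" for y
    by (rule depends_uptoD[OF iterate_depends_upto]) auto
  then have "noise \<alpha> (x(Suc t := y)) t = \<gamma> * (greedy \<alpha> x t (fst y) - ?c)" for y
    by (simp add: noise_def greedy_def)
  then have "(\<Sum>y\<in>UNIV. pair_kernel (x t) y * noise \<alpha> (x(Suc t := y)) t)
      = (\<Sum>s\<in>UNIV. p (fst (x t)) (snd (x t)) s * (\<gamma> * (greedy \<alpha> x t s - ?c)))"
    using sum_pair_kernel[of "x t" "\<lambda>s. \<gamma> * (greedy \<alpha> x t s - ?c)"] by simp
  also have "\<dots> = \<gamma> * ?c - \<gamma> * ?c * (\<Sum>s\<in>UNIV. p (fst (x t)) (snd (x t)) s)"
  proof -
    have "p (fst (x t)) (snd (x t)) s * (\<gamma> * (greedy \<alpha> x t s - c))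
        = \<gamma> * (p (fst (x t)) (snd (x t)) s * greedy \<alpha> x t s) - \<gamma> * c * p (fst (x t)) (snd (x t)) s" for s c
      by (simp add: algebra_simps)
    then show ?thesis by (simp only: sum_subtractf sum_distrib_left[symmetric])
  qed
  also have "\<dots> = 0" by (simp add: p_sum)
  finally show ?thesis .
qed

text \<open>The fixed point equation replaces \<open>qstar\<close> by its Bellman image, which
  cancels the reward; adding and subtracting the mean greedy value splits the rest into a
  contraction and a martingale difference.\<close>

lemma err_Suc:
  "err \<alpha> x (Suc t) y = (if y = x t
     then (1 - \<alpha> t) * err \<alpha> x t y + \<alpha> t * (drift \<alpha> x t + noise \<alpha> x t) else err \<alpha> x t y)"
proof (cases "y = x t")
  case True
  obtain s a where sa: "y = (s, a)" by (cases y)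
  have "qstar s a = r s a + \<gamma> * (\<Sum>s'\<in>UNIV. p s a s' * Max (range (qstar s')))"
    using fun_cong[OF fun_cong[OF qstar], of s a] by (simp add: bellman_def)
  moreover have "drift \<alpha> x t + noise \<alpha> x t
      = \<gamma> * greedy \<alpha> x t (fst (x (Suc t))) - \<gamma> * (\<Sum>s'\<in>UNIV. p s a s' * Max (range (qstar s')))"
    using True[symmetric] by (simp add: drift_def noise_def sa right_diff_distrib sum_subtractf)
  ultimately have "drift \<alpha> x t + noise \<alpha> x t = r s a + \<gamma> * greedy \<alpha> x t (fst (x (Suc t))) - qstar s a"
    by simp
  with True[symmetric] show ?thesis by (simp only: err_def iterate_Suc sa fst_conv snd_conv) (simp add: algebra_simps)
next
  case False
  then show ?thesis by (simp add: err_def iterate_Suc)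
qed

lemma drift_bound:
  assumes "\<And>y. \<bar>err \<alpha> x t y\<bar> \<le> E"
  shows "\<bar>drift \<alpha> x t\<bar> \<le> \<gamma> * E"
proof -
  have "\<bar>greedy \<alpha> x t s - Max (range (qstar s))\<bar> \<le> E" for s
    unfolding greedy_def using assms[of "(s, _)"] by (intro Max_range_diff_le) (simp add: err_def)
  then have "\<bar>\<Sum>s\<in>UNIV. p (fst (x t)) (snd (x t)) s * (greedy \<alpha> x t s - Max (range (qstar s)))\<bar>
      \<le> (\<Sum>s\<in>UNIV. p (fst (x t)) (snd (x t)) s * E)"
    by (intro order_trans[OF sum_abs] sum_mono) (simp add: abs_mult p_nonneg mult_left_mono)
  also have "\<dots> = E" by (simp add: sum_distrib_right[symmetric] p_sum)
  finally show ?thesis using gamma by (simp add: drift_def abs_mult mult_left_mono)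
qed

lemma noise_bound:
  assumes Q: "\<And>s a. \<bar>iterate \<alpha> x t s a\<bar> \<le> Q"
  shows "\<bar>noise \<alpha> x t\<bar> \<le> 2 * Q"
proof -
  have v: "\<bar>greedy \<alpha> x t s\<bar> \<le> Q" for s
    unfolding greedy_def by (intro abs_Max_range_le Q)
  have "\<bar>\<Sum>s\<in>UNIV. p (fst (x t)) (snd (x t)) s * greedy \<alpha> x t s\<bar>
      \<le> (\<Sum>s\<in>UNIV. p (fst (x t)) (snd (x t)) s * Q)"
    by (intro order_trans[OF sum_abs] sum_mono) (simp add: abs_mult p_nonneg mult_left_mono v)
  also have "\<dots> = Q" by (simp add: sum_distrib_right[symmetric] p_sum)
  finally have "\<bar>greedy \<alpha> x t (fst (x (Suc t))) - (\<Sum>s\<in>UNIV. p (fst (x t)) (snd (x t)) s * greedy \<alpha> x t s)\<bar> \<le> 2 * Q"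
    using v[of "fst (x (Suc t))"] by linarith
  then have "\<bar>noise \<alpha> x t\<bar> \<le> 1 * (2 * Q)"
    unfolding noise_def abs_mult using gamma by (intro mult_mono) auto
  then show ?thesis by simp
qed

text \<open>Early steps may exceed 1, but finitely many of them enlarge the iterates only by a
  finite amount, uniformly over all paths. From \<open>T\<close> on an update is a convex
  combination, and balls of radius at least \<open>R / (1 - \<gamma>)\<close> are invariant because
  \<open>R + \<gamma> * Q \<le> Q\<close>.\<close>

lemma iterates_bounded:
  assumes \<alpha>: "\<And>t. 0 \<le> \<alpha> t" "\<And>t. T \<le> t \<Longrightarrow> \<alpha> t \<le> 1"
  obtains Q where "0 < Q" "\<And>x t s a. \<bar>iterate \<alpha> x t s a\<bar> \<le> Q"
proof -
  define R where "R = (\<Sum>y\<in>UNIV. \<bar>r (fst y) (snd y)\<bar>)"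
  have R: "\<bar>r s a\<bar> \<le> R" for s a
    using member_le_sum[of "(s, a)" UNIV "\<lambda>y. \<bar>r (fst y) (snd y)\<bar>"] by (simp add: R_def)
  have v: "\<bar>greedy \<alpha> x t s\<bar> \<le> Q" if "\<And>s a. \<bar>iterate \<alpha> x t s a\<bar> \<le> Q" for x t s Q
    unfolding greedy_def by (intro abs_Max_range_le that)
  have finite_horizon: "\<exists>Q. \<forall>t\<le>n. \<forall>x s a. \<bar>iterate \<alpha> x t s a\<bar> \<le> Q" for n
  proof (induction n)
    case 0
    have "\<bar>q0 s a\<bar> \<le> (\<Sum>y\<in>UNIV. \<bar>q0 (fst y) (snd y)\<bar>)" for s a
      using member_le_sum[of "(s, a)" UNIV "\<lambda>y. \<bar>q0 (fst y) (snd y)\<bar>"] by simp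
    then show ?case by (auto simp: iterate_def)
  next
    case (Suc n)
    then obtain Q where Q: "\<And>t x s a. t \<le> n \<Longrightarrow> \<bar>iterate \<alpha> x t s a\<bar> \<le> Q" by blast
    have Q0: "0 \<le> Q" using abs_ge_zero[of "iterate \<alpha> undefined 0 undefined undefined"] Q[of 0] by (rule order_trans) simp
    have R0: "0 \<le> R" by (simp add: R_def sum_nonneg)
    define Q' where "Q' = Q + \<alpha> n * (R + Q + Q)"
    have QQ: "Q \<le> Q'" unfolding Q'_def using \<alpha>(1)[of n] Q0 R0 by simp
    have "\<bar>iterate \<alpha> x (Suc n) s a\<bar> \<le> Q'" for x s a
    proof (cases "(s, a) = x n")
      case True
      let ?v = "greedy \<alpha> x n (fst (x (Suc n)))" and ?q = "iterate \<alpha> x n s a"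
      have "\<bar>\<gamma> * ?v\<bar> \<le> 1 * Q" unfolding abs_mult
        using gamma v[of x n Q] Q by (intro mult_mono) auto
      then have "\<bar>r s a + \<gamma> * ?v - ?q\<bar> \<le> R + Q + Q" using R[of s a] Q[of n x s a] by linarith
      then have "\<bar>\<alpha> n * (r s a + \<gamma> * ?v - ?q)\<bar> \<le> \<alpha> n * (R + Q + Q)"
        using \<alpha>(1)[of n] by (simp add: abs_mult mult_left_mono)
      then show ?thesis using True Q[of n x s a] by (simp add: iterate_Suc Q'_def)
    next
      case False
      then show ?thesis using Q[of n x s a] QQ by (simp add: iterate_Suc)
    qed
    moreover have "\<bar>iterate \<alpha> x t s a\<bar> \<le> Q'" if "t \<le> n" for t x s a
      using Q[OF that, of x s a] QQ by linarith
    ultimately show ?case unfolding le_Suc_eq by blast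
  qed
  from finite_horizon[of T]
  obtain Q1 where Q1: "\<And>t x s a. t \<le> T \<Longrightarrow> \<bar>iterate \<alpha> x t s a\<bar> \<le> Q1" by blast
  define Q where "Q = max 1 (max Q1 (R / (1 - \<gamma>)))"
  have "R / (1 - \<gamma>) \<le> Q" by (simp add: Q_def)
  then have RQ: "R + \<gamma> * Q \<le> Q" using gamma by (simp add: field_simps)
  have "\<bar>iterate \<alpha> x t s a\<bar> \<le> Q" for x t s a
  proof (cases "t \<le> T")
    case True
    then show ?thesis using Q1[of t x s a] by (simp add: Q_def)
  next
    case False
    then have "T \<le> t" by simp
    then show ?thesis
    proof (induction t arbitrary: s a rule: dec_induct)
      case base
      then show ?case using Q1[of T x s a] by (simp add: Q_def)
    next
      case (step t)
      show ?case
      proof (cases "(s, a) = x t")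
        case True
        let ?v = "greedy \<alpha> x t (fst (x (Suc t)))" and ?q = "iterate \<alpha> x t s a"
        have "\<bar>\<gamma> * ?v\<bar> \<le> \<gamma> * Q" using gamma v[OF step.IH] by (simp add: abs_mult mult_left_mono)
        then have "\<bar>r s a + \<gamma> * ?v\<bar> \<le> Q" using R[of s a] RQ by linarith
        then have "\<bar>\<alpha> t * (r s a + \<gamma> * ?v)\<bar> \<le> \<alpha> t * Q" using \<alpha>(1) by (simp add: abs_mult mult_left_mono)
        moreover have "\<bar>(1 - \<alpha> t) * ?q\<bar> \<le> (1 - \<alpha> t) * Q"
          using \<alpha>(2)[OF step.hyps(1)] step.IH[of s a] by (simp add: abs_mult mult_left_mono)
        moreover have "iterate \<alpha> x (Suc t) s a = (1 - \<alpha> t) * ?q + \<alpha> t * (r s a + \<gamma> * ?v)"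
          using True by (simp add: iterate_Suc algebra_simps)
        moreover have "(1 - \<alpha> t) * Q + \<alpha> t * Q = Q" by (simp add: algebra_simps)
        ultimately show ?thesis by linarith
      next
        case False
        then show ?thesis using step.IH[of s a] by (simp add: iterate_Suc)
      qed
    qed
  qed
  moreover have "0 < Q" by (simp add: Q_def)
  ultimately show ?thesis using that by blast
qed

end

section \<open>High probability decay from a late time on\<close>

context q_learning
begin

text \<open>There are finitely many targets, so one height \<open>H\<close> serves all of them and
  yields one visit rate for all pairs.\<close>

lemma drift_functions:
  obtains h H where "0 < H" "\<And>y. h y y = 0" "\<And>y x. 0 \<le> h y x" "\<And>y x. h y x \<le> H"
    "\<And>y x. x \<noteq> y \<Longrightarrow> (\<Sum>z\<in>UNIV. pair_kernel x z * h y z) \<le> h y x - 1"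
proof -
  have "\<forall>y. \<exists>hH. 0 < snd hH \<and> fst hH y = 0 \<and> (\<forall>x. 0 \<le> fst hH x \<and> fst hH x \<le> snd hH) \<and>
      (\<forall>x. x \<noteq> y \<longrightarrow> (\<Sum>z\<in>UNIV. pair_kernel x z * fst hH z) \<le> fst hH x - 1)"
  proof
    fix y
    obtain h H where "0 < H" "h y = 0" "\<And>x. 0 \<le> h x" "\<And>x. h x \<le> H"
      "\<And>x. x \<noteq> y \<Longrightarrow> (\<Sum>z\<in>UNIV. pair_kernel x z * h z) \<le> h x - 1"
      by (rule drift_function_exists[OF P_nonneg P_sum pair_kernel_reaches[of _ y]]) (rule that)
    then show "\<exists>hH. 0 < snd hH \<and> fst hH y = 0 \<and> (\<forall>x. 0 \<le> fst hH x \<and> fst hH x \<le> snd hH) \<and>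
      (\<forall>x. x \<noteq> y \<longrightarrow> (\<Sum>z\<in>UNIV. pair_kernel x z * fst hH z) \<le> fst hH x - 1)"
      by (intro exI[of _ "(h, H)"]) simp
  qed
  from choice[OF this] obtain f where f: "\<forall>y. 0 < snd (f y) \<and> fst (f y) y = 0 \<and>
      (\<forall>x. 0 \<le> fst (f y) x \<and> fst (f y) x \<le> snd (f y)) \<and>
      (\<forall>x. x \<noteq> y \<longrightarrow> (\<Sum>z\<in>UNIV. pair_kernel x z * fst (f y) z) \<le> fst (f y) x - 1)" ..
  define h H where "h y = fst (f y)" and "H y = snd (f y)" for y
  have hH: "0 < H y" "h y y = 0" "0 \<le> h y x" "h y x \<le> H y"
    "x \<noteq> y \<Longrightarrow> (\<Sum>z\<in>UNIV. pair_kernel x z * h y z) \<le> h y x - 1" for y x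
    using f unfolding h_def H_def by blast+
  have "H y \<le> Max (range H)" for y by simp
  then have "0 < Max (range H)" "h y x \<le> Max (range H)" for y x
    using less_le_trans[OF hH(1)] order_trans[OF hH(4)] by blast+
  with hH(2,3,5) show ?thesis by (intro that[of "Max (range H)" h])
qed

lemma decay_event_measurable:
  "{\<omega> \<in> space M. \<forall>t\<ge>m. \<forall>y. \<bar>err \<alpha> (path \<omega>) t y\<bar> \<le> f t} \<in> events"
proof -
  have [measurable]: "(\<lambda>\<omega>. err \<alpha> (path \<omega>) t y) \<in> borel_measurable M" for t y
    by (rule path_function_measurable[OF err_depends_upto])
  show ?thesis by measurable
qed

text \<open>Two failure events for each pair, each bounded by the two-sided \<open>azuma\<close>,
  account for the factor 4; outside them the pathwise contraction applies with \<open>B = Q\<close>.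
  The number \<open>v\<close> measures the noise variance from \<open>m\<close> on relative to
  \<open>(g m)\<^sup>2\<close>, so the size of \<open>g m\<close> drops out.\<close>

lemma decay_probability_bound:
  fixes h :: "'s \<times> 'a \<Rightarrow> 's \<times> 'a \<Rightarrow> real"
  assumes H: "0 < H" and h_0: "\<And>y. h y y = 0"
    and h_bounds: "\<And>y x. 0 \<le> h y x" "\<And>y x. h y x \<le> H"
    and h_drift: "\<And>y x. x \<noteq> y \<Longrightarrow> (\<Sum>z\<in>UNIV. pair_kernel x z * h y z) \<le> h y x - 1"
    and c: "c = (1 - \<gamma>) * (1 / (H + 1)) / 8"
    and \<alpha>: "\<And>t. 0 \<le> \<alpha> t" "\<And>t. \<alpha> (Suc t) \<le> \<alpha> t" "\<alpha> m \<le> 1 / 8"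
    and g: "\<And>t. 0 < g t" "\<And>t. g t \<le> g (Suc t)" "\<And>t. m \<le> t \<Longrightarrow> g (Suc t) \<le> exp (c * \<alpha> t) * g t"
    and Q: "0 < Q" "\<And>x t s a. \<bar>iterate \<alpha> x t s a\<bar> \<le> Q" "\<And>x t y. \<bar>err \<alpha> x t y\<bar> \<le> Q"
    and v: "0 < v" "\<And>n. (\<Sum>k=m..<n. (g (Suc k) * \<alpha> k)\<^sup>2) \<le> v * (g m)\<^sup>2"
  shows "1 - 4 * real CARD('s \<times> 'a) * exp (- ((1 - \<gamma>)\<^sup>2 / 4096) / v)
    \<le> prob {\<omega> \<in> space M. \<forall>t\<ge>m. \<forall>y. \<bar>err \<alpha> (path \<omega>) t y\<bar> \<le> 3 * Q * g m / g t}"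
proof -
  \<comment> \<open>Makes \<open>d * H = 1 - d\<close>: at a visit to \<open>y\<close> the process
    \<open>D\<close> below rises by at most \<open>\<alpha> t * (1 - d)\<close>, and elsewhere the
    unit drift of \<open>h y\<close> lowers it by at least \<open>\<alpha> t * d\<close>.\<close>
  define d where "d = 1 / (H + 1)"
  have d: "0 < d" "d \<le> 1" "d * H \<le> 1" using H by (auto simp: d_def field_simps)
  define Ph where "Ph y x = (\<Sum>z\<in>UNIV. pair_kernel x z * h y z)" for y x
  have Ph_bounds: "0 \<le> Ph y x" "Ph y x \<le> H" for y x
  proof -
    show "0 \<le> Ph y x" unfolding Ph_def by (intro sum_nonneg mult_nonneg_nonneg P_nonneg h_bounds)
    have "Ph y x \<le> (\<Sum>z\<in>UNIV. pair_kernel x z * H)"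
      unfolding Ph_def by (intro sum_mono mult_left_mono P_nonneg h_bounds)
    then show "Ph y x \<le> H" by (simp add: sum_distrib_right[symmetric] P_sum)
  qed
  \<comment> \<open>Both martingale differences are set to 0 before time \<open>m\<close>, so that
    \<open>azuma\<close>, whose sums start at 0, controls the sums from \<open>m\<close> on.\<close>
  define WZ where "WZ y k x = (if m \<le> k \<and> x k = y then g (Suc k) * \<alpha> k * noise \<alpha> x k else 0)" for y k x
  define WD where "WD y k x = (if m \<le> k then \<alpha> k * (d * (h y (x (Suc k)) - Ph y (x k))) else 0)"
    for y k and x :: "nat \<Rightarrow> 's \<times> 'a"
  have split_sum: "(\<Sum>k<n. if m \<le> k then f k else 0) = (\<Sum>k=m..<n. f k)" for n and f :: "nat \<Rightarrow> real"
    by (subst sum.inter_filter[symmetric]) (auto intro!: sum.cong)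
  define \<epsilon> where "\<epsilon> = (1 - \<gamma>) / 16 * Q * g m"
  have \<epsilon>: "0 < \<epsilon>" using gamma Q g(1)[of m] by (simp add: \<epsilon>_def)
  define EZ where "EZ y = {\<omega> \<in> space M. \<exists>n. \<epsilon> \<le> \<bar>\<Sum>k<n. WZ y k (path \<omega>)\<bar>}" for y
  define ED where "ED y = {\<omega> \<in> space M. \<exists>n. 1 / 8 \<le> \<bar>\<Sum>k<n. WD y k (path \<omega>)\<bar>}" for y
  let ?E = "exp (- ((1 - \<gamma>)\<^sup>2 / 4096) / v)"

  have EZ: "EZ y \<in> events \<and> prob (EZ y) \<le> 2 * ?E" for y
  proof -
    define b where "b k = (if m \<le> k then g (Suc k) * \<alpha> k * (2 * Q) else 0)" for k
    \<comment> \<open>The factor 4 comes from the noise bound \<open>2 * Q\<close>. With the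
      tolerance \<open>\<epsilon>\<close> the exponent becomes
      \<open>(1 / 16)\<^sup>2 / 16 = 1 / 4096\<close> times
      \<open>(1 - \<gamma>)\<^sup>2 / v\<close>.\<close>
    define V where "V = 4 * Q\<^sup>2 * (v * (g m)\<^sup>2)"
    have dep: "depends_upto (Suc k) (WZ y k)" for k
      using noise_depends_upto[of k \<alpha>] unfolding depends_upto_def WZ_def by (metis le_SucI le_refl)
    have mean: "(\<Sum>z\<in>UNIV. pair_kernel (x k) z * WZ y k (x(Suc k := z))) = 0" for k x
    proof -
      have "pair_kernel (x k) z * WZ y k (x(Suc k := z))
          = (if m \<le> k \<and> x k = y then g (Suc k) * \<alpha> k else 0) * (pair_kernel (x k) z * noise \<alpha> (x(Suc k := z)) k)" for z
        by (simp add: WZ_def)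
      then show ?thesis by (simp only: sum_distrib_left[symmetric] noise_mean_zero mult_zero_right)
    qed
    have bound: "\<bar>WZ y k x\<bar> \<le> b k" for k x
    proof -
      have "\<bar>noise \<alpha> x k\<bar> \<le> 2 * Q" by (rule noise_bound[OF Q(2)])
      then have "\<bar>g (Suc k) * \<alpha> k * noise \<alpha> x k\<bar> \<le> g (Suc k) * \<alpha> k * (2 * Q)"
        using \<alpha>(1)[of k] g(1)[of "Suc k"] by (simp add: abs_mult mult_left_mono)
      then show ?thesis using \<alpha>(1)[of k] g(1)[of "Suc k"] Q(1) by (simp add: WZ_def b_def)
    qed
    have V_bound: "(\<Sum>k<n. (b k)\<^sup>2) \<le> V" for n
    proof -
      have "(\<Sum>k<n. (b k)\<^sup>2) = (\<Sum>k<n. if m \<le> k then 4 * Q\<^sup>2 * (g (Suc k) * \<alpha> k)\<^sup>2 else 0)"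
        by (intro sum.cong refl) (simp add: b_def power_mult_distrib)
      also have "\<dots> = 4 * Q\<^sup>2 * (\<Sum>k=m..<n. (g (Suc k) * \<alpha> k)\<^sup>2)"
        unfolding split_sum by (simp add: sum_distrib_left)
      also have "\<dots> \<le> V" unfolding V_def by (intro mult_left_mono v) auto
      finally show ?thesis .
    qed
    have V0: "0 < V" using Q v g(1)[of m] by (simp add: V_def)
    have "\<epsilon>\<^sup>2 / (4 * V) = ((1 - \<gamma>)\<^sup>2 / 4096) / v"
      using Q v g(1)[of m] by (simp add: \<epsilon>_def V_def field_simps power2_eq_square)
    with azuma[OF dep mean bound V_bound V0 \<epsilon>] show ?thesis by (simp add: EZ_def)
  qed

  have ED: "ED y \<in> events \<and> prob (ED y) \<le> 2 * ?E" for y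
  proof -
    define b where "b k = (if m \<le> k then \<alpha> k else 0)" for k
    have dep: "depends_upto (Suc k) (WD y k)" for k
      unfolding depends_upto_def WD_def by simp
    have mean: "(\<Sum>z\<in>UNIV. pair_kernel (x k) z * WD y k (x(Suc k := z))) = 0" for k x
    proof -
      have "pair_kernel (x k) z * WD y k (x(Suc k := z))
          = (if m \<le> k then \<alpha> k * d else 0) * (pair_kernel (x k) z * h y z)
            - (if m \<le> k then \<alpha> k * d else 0) * Ph y (x k) * pair_kernel (x k) z" for z
        by (simp add: WD_def algebra_simps)
      then show ?thesis
        by (simp add: sum_subtractf sum_distrib_left[symmetric] P_sum Ph_def[symmetric])
    qed
    have bound: "\<bar>WD y k x\<bar> \<le> b k" for k x
    proof -
      have "\<bar>h y (x (Suc k)) - Ph y (x k)\<bar> \<le> H"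
        using h_bounds[of y "x (Suc k)"] Ph_bounds[of y "x k"] by linarith
      then have "d * \<bar>h y (x (Suc k)) - Ph y (x k)\<bar> \<le> d * H" using d by (intro mult_left_mono) auto
      with d have "\<bar>d * (h y (x (Suc k)) - Ph y (x k))\<bar> \<le> 1" unfolding abs_mult by linarith
      then have "\<alpha> k * \<bar>d * (h y (x (Suc k)) - Ph y (x k))\<bar> \<le> \<alpha> k * 1"
        using \<alpha>(1)[of k] by (intro mult_left_mono) auto
      then show ?thesis using \<alpha>(1)[of k] by (simp add: WD_def b_def abs_mult)
    qed
    have V_bound: "(\<Sum>k<n. (b k)\<^sup>2) \<le> v" for n
    proof -
      have "(\<Sum>k<n. (b k)\<^sup>2) = (\<Sum>k<n. if m \<le> k then (\<alpha> k)\<^sup>2 else 0)"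
        by (intro sum.cong refl) (simp add: b_def)
      also have "\<dots> = (\<Sum>k=m..<n. (\<alpha> k)\<^sup>2)" by (rule split_sum)
      finally have eq: "(\<Sum>k<n. (b k)\<^sup>2) = (\<Sum>k=m..<n. (\<alpha> k)\<^sup>2)" .
      \<comment> \<open>The hypothesis on \<open>v\<close> also covers the unweighted steps, because
        \<open>g m \<le> g (Suc k)\<close> for \<open>k \<ge> m\<close>; one \<open>v\<close> thus
        serves both kinds of events.\<close>
      have "(g m)\<^sup>2 * (\<Sum>k=m..<n. (\<alpha> k)\<^sup>2) \<le> (\<Sum>k=m..<n. (g (Suc k) * \<alpha> k)\<^sup>2)"
        unfolding sum_distrib_left
      proof (rule sum_mono)
        fix k assume "k \<in> {m..<n}"
        then have "g m \<le> g (Suc k)" using lift_Suc_mono_le[of g m "Suc k"] g(2) by auto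
        then show "(g m)\<^sup>2 * (\<alpha> k)\<^sup>2 \<le> (g (Suc k) * \<alpha> k)\<^sup>2"
          unfolding power_mult_distrib using g(1)[of m] by (intro mult_right_mono power_mono) auto
      qed
      also have "\<dots> \<le> v * (g m)\<^sup>2" by (rule v)
      finally show ?thesis unfolding eq using g(1)[of m] by (simp add: mult.commute)
    qed
    have "(1 - \<gamma>)\<^sup>2 \<le> 1" using gamma by (simp add: power_le_one)
    then have "((1 - \<gamma>)\<^sup>2 / 4096) / v \<le> (1 / 256) / v"
      using v(1) by (intro divide_right_mono) auto
    then have le: "exp (- (1 / 8)\<^sup>2 / (4 * v)) \<le> ?E" by (simp add: power2_eq_square)
    have "0 < (1 / 8 :: real)" by simp
    note az = azuma[OF dep mean bound V_bound v(1) this]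
    show ?thesis
    proof
      show "ED y \<in> events" unfolding ED_def by (rule az(1))
      show "prob (ED y) \<le> 2 * ?E" using az(2) le unfolding ED_def by linarith
    qed
  qed

  have pathwise: "\<bar>err \<alpha> (path \<omega>) t y\<bar> \<le> 3 * Q * g m / g t"
    if \<omega>: "\<omega> \<in> space M" "\<And>y. \<omega> \<notin> EZ y" "\<And>y. \<omega> \<notin> ED y" and t: "m \<le> t" for \<omega> t y
  proof -
    let ?x = "path \<omega>"
    define Z where "Z t y = (\<Sum>k<t. WZ y k ?x)" for t y
    \<comment> \<open>The accumulated drift of \<open>h y\<close> along the path. It equals a
      telescoping sum minus the martingale of \<open>WD\<close>, and each part contributes at most
      1/8, the first by Abel summation and \<open>\<alpha> m \<le> 1 / 8\<close>.\<close>
    define D where "D t y = (\<Sum>k<t. if m \<le> k then \<alpha> k * (d * (Ph y (?x k) - h y (?x k))) else 0)" for t y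
    have Z_bound: "\<bar>Z t y\<bar> \<le> \<epsilon>" for t y
      using \<omega>(1) \<omega>(2)[of y] by (auto simp: EZ_def Z_def not_le intro: less_imp_le)
    have D_bound: "\<bar>D t y\<bar> \<le> 1 / 4" if "m \<le> t" for t y
    proof -
      let ?T = "\<Sum>k<t. if m \<le> k then \<alpha> k * (d * h y (?x (Suc k)) - d * h y (?x k)) else 0"
      have "D t y = ?T - (\<Sum>k<t. WD y k ?x)"
        unfolding D_def WD_def sum_subtractf[symmetric] by (intro sum.cong refl) (simp add: algebra_simps)
      moreover have "\<bar>?T\<bar> \<le> \<alpha> m * (d * H)"
        by (rule abel_sum_bound[where h = "\<lambda>k. d * h y (?x k)"])
          (use that \<alpha> d h_bounds in \<open>auto intro: mult_left_mono\<close>)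
      moreover have "\<alpha> m * (d * H) \<le> 1 / 8 * 1" using \<alpha> d H by (intro mult_mono) auto
      moreover have "\<bar>\<Sum>k<t. WD y k ?x\<bar> < 1 / 8"
        using \<omega>(1) \<omega>(3)[of y] by (auto simp: ED_def not_le)
      ultimately show ?thesis by linarith
    qed
    have D_step: "D (Suc t) y - D t y \<le> \<alpha> t * ((if y = ?x t then 1 else 0) - d)" if "m \<le> t" for t y
    proof -
      have "d * (Ph y (?x t) - h y (?x t)) \<le> (if y = ?x t then 1 else 0) - d"
      proof (cases "y = ?x t")
        case True
        have "d * Ph y (?x t) \<le> d * H" using d Ph_bounds by (intro mult_left_mono) auto
        also have "d * H = 1 - d" using H by (simp add: d_def field_simps)
        finally show ?thesis using True h_0[of y] by simp
      next
        case False
        then have "Ph y (?x t) - h y (?x t) \<le> -1" using h_drift[of "?x t" y] by (auto simp: Ph_def)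
        then have "d * (Ph y (?x t) - h y (?x t)) \<le> d * (-1)" using d by (intro mult_left_mono) auto
        then show ?thesis using False by simp
      qed
      from mult_left_mono[OF this \<alpha>(1)[of t]] show ?thesis using that by (simp add: D_def)
    qed
    have "\<alpha> t \<le> \<alpha> m" if "m \<le> t" for t
      using lift_Suc_antimono_le[of \<alpha> m t] \<alpha>(2) that by auto
    then have \<alpha>1: "\<alpha> t \<le> 1" if "m \<le> t" for t using \<alpha>(3) that by fastforce
    show ?thesis
    proof (rule asynchronous_contraction_decay[where e = "err \<alpha> ?x" and Z = Z and D = D and Y = ?x
          and F = "drift \<alpha> ?x" and w = "noise \<alpha> ?x" and d = d and \<alpha> = \<alpha> and \<gamma> = \<gamma> and B = Q
          and l = "(1 - \<gamma>) / 4"])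
      show "0 \<le> \<gamma>" "\<gamma> < 1" "0 < d" "d \<le> 1" using gamma d by auto
      show "c = (1 - \<gamma>) * d / 8" by (simp add: c d_def)
      show "Z m y = 0" "D m y = 0" for y
        by (auto simp: Z_def D_def WZ_def intro!: sum.neutral)
      show "Z (Suc t) y = Z t y + (if y = ?x t then g (Suc t) * \<alpha> t * noise \<alpha> ?x t else 0)" if "m \<le> t" for t y
        using that by (auto simp: Z_def WZ_def)
      show "\<bar>Z t y\<bar> \<le> (1 - \<gamma>) / 16 * Q * g m" if "m \<le> t" for t y using Z_bound by (simp add: \<epsilon>_def)
      show "\<bar>drift \<alpha> ?x t\<bar> \<le> \<gamma> * E" if "\<And>y. \<bar>err \<alpha> ?x t y\<bar> \<le> E" for t E
        using that by (rule drift_bound)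
      show "err \<alpha> ?x (Suc t) y = (if y = ?x t
          then (1 - \<alpha> t) * err \<alpha> ?x t y + \<alpha> t * (drift \<alpha> ?x t + noise \<alpha> ?x t) else err \<alpha> ?x t y)" for t y
        by (rule err_Suc)
    qed (use \<alpha> \<alpha>1 g Q t D_bound D_step in auto)
  qed

  let ?G = "{\<omega> \<in> space M. \<forall>t\<ge>m. \<forall>y. \<bar>err \<alpha> (path \<omega>) t y\<bar> \<le> 3 * Q * g m / g t}"
  let ?U = "\<Union>y. EZ y \<union> ED y"
  have U: "?U \<in> events" using EZ ED by (intro sets.finite_UN) auto
  have "prob ?U \<le> (\<Sum>y\<in>UNIV. prob (EZ y \<union> ED y))"
    using EZ ED by (intro finite_measure_subadditive_finite) auto
  also have "\<dots> \<le> (\<Sum>y::'s \<times> 'a\<in>UNIV. 4 * ?E)"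
  proof (rule sum_mono)
    fix y
    have "prob (EZ y \<union> ED y) \<le> prob (EZ y) + prob (ED y)" using EZ ED by (intro measure_Un_le) auto
    then show "prob (EZ y \<union> ED y) \<le> 4 * ?E" using EZ[of y] ED[of y] by linarith
  qed
  also have "\<dots> = 4 * real CARD('s \<times> 'a) * ?E" by simp
  finally have "1 - 4 * real CARD('s \<times> 'a) * ?E \<le> prob (space M - ?U)"
    using U by (simp add: prob_compl)
  also have "\<dots> \<le> prob ?G"
    using pathwise by (intro finite_measure_mono decay_event_measurable) auto
  finally show ?thesis .
qed

text \<open>The constant \<open>c\<close> is fixed by the chain and \<open>\<gamma>\<close> before
  the steps and the growth rate are chosen, so it may enter thresholds on \<open>C\<alpha>\<close>.
  The same \<open>C\<close> also bounds the errors at all times, which takes care of the times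
  before \<open>m\<close>.\<close>

lemma decay_in_probability:
  obtains c where "0 < c" and
    "\<And>\<alpha> g v. \<lbrakk>\<And>t. 0 \<le> \<alpha> t; \<And>t. \<alpha> (Suc t) \<le> \<alpha> t; \<alpha> \<longlonglongrightarrow> 0;
      \<And>t. 0 < g t; \<And>t. g t \<le> g (Suc t); \<forall>\<^sub>F t in sequentially. g (Suc t) \<le> exp (c * \<alpha> t) * g t;
      \<And>m. 0 < v m; \<And>m n. (\<Sum>k=m..<n. (g (Suc k) * \<alpha> k)\<^sup>2) \<le> v m * (g m)\<^sup>2\<rbrakk>
    \<Longrightarrow> \<exists>C \<kappa> N T. 0 < C \<and> 0 < \<kappa> \<and> 1 \<le> N \<and> (\<forall>x t y. \<bar>err \<alpha> x t y\<bar> \<le> C) \<and>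
      (\<forall>m\<ge>T. 1 - N * exp (- \<kappa> / v m)
        \<le> prob {\<omega> \<in> space M. \<forall>t\<ge>m. \<forall>y. \<bar>err \<alpha> (path \<omega>) t y\<bar> \<le> C * g m / g t})"
proof -
  obtain h H where hH: "0 < H" "\<And>y. h y y = 0" "\<And>y x. 0 \<le> h y x" "\<And>y x. h y x \<le> H"
    "\<And>y x. x \<noteq> y \<Longrightarrow> (\<Sum>z\<in>UNIV. pair_kernel x z * h y z) \<le> h y x - 1"
    by (rule drift_functions) (rule that)
  define c where "c = (1 - \<gamma>) * (1 / (H + 1)) / 8"
  show ?thesis
  proof (rule that[of c])
    show "0 < c" using gamma hH(1) by (simp add: c_def)
    fix \<alpha> g v :: "nat \<Rightarrow> real"
    assume \<alpha>: "\<And>t. 0 \<le> \<alpha> t" "\<And>t. \<alpha> (Suc t) \<le> \<alpha> t" "\<alpha> \<longlonglongrightarrow> 0"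
      and g: "\<And>t. 0 < g t" "\<And>t. g t \<le> g (Suc t)" "\<forall>\<^sub>F t in sequentially. g (Suc t) \<le> exp (c * \<alpha> t) * g t"
      and v: "\<And>m. 0 < v m" "\<And>m n. (\<Sum>k=m..<n. (g (Suc k) * \<alpha> k)\<^sup>2) \<le> v m * (g m)\<^sup>2"
    have "\<forall>\<^sub>F t in sequentially. \<alpha> t < 1 / 8"
      using order_tendstoD(2)[OF \<alpha>(3), of "1 / 8"] by simp
    from eventually_conj[OF this g(3)]
    obtain T where T: "\<And>t. T \<le> t \<Longrightarrow> \<alpha> t < 1 / 8" "\<And>t. T \<le> t \<Longrightarrow> g (Suc t) \<le> exp (c * \<alpha> t) * g t"
      unfolding eventually_sequentially by blast
    have \<alpha>1: "\<alpha> t \<le> 1" if "T \<le> t" for t using T(1)[OF that] by linarith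
    obtain Q0 where Q0: "0 < Q0" "\<And>x t s a. \<bar>iterate \<alpha> x t s a\<bar> \<le> Q0"
      by (rule iterates_bounded[of \<alpha> T]) (use \<alpha>(1) \<alpha>1 in auto)
    define Q where "Q = Q0 + (\<Sum>y\<in>UNIV. \<bar>qstar (fst y) (snd y)\<bar>)"
    have "0 \<le> (\<Sum>y\<in>UNIV. \<bar>qstar (fst y) (snd y)\<bar>)" by (intro sum_nonneg) auto
    then have "0 < Q" "Q0 \<le> Q" using Q0(1) unfolding Q_def by linarith+
    then have Q: "0 < Q" "\<And>x t s a. \<bar>iterate \<alpha> x t s a\<bar> \<le> Q"
      by (auto intro: order_trans[OF Q0(2)])
    have Qe: "\<bar>err \<alpha> x t y\<bar> \<le> Q" for x t y
    proof -
      have "\<bar>qstar (fst y) (snd y)\<bar> \<le> (\<Sum>y\<in>UNIV. \<bar>qstar (fst y) (snd y)\<bar>)"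
        by (rule member_le_sum) auto
      then show ?thesis using Q0(2)[of x t "fst y" "snd y"] unfolding err_def Q_def by linarith
    qed
    define N where "N = 4 * real CARD('s \<times> 'a)"
    have "1 - N * exp (- ((1 - \<gamma>)\<^sup>2 / 4096) / v m)
        \<le> prob {\<omega> \<in> space M. \<forall>t\<ge>m. \<forall>y. \<bar>err \<alpha> (path \<omega>) t y\<bar> \<le> 3 * Q * g m / g t}" if "T \<le> m" for m
    proof -
      have \<alpha>m: "\<alpha> m \<le> 1 / 8" using T(1)[OF that] by simp
      have growth: "g (Suc t) \<le> exp (c * \<alpha> t) * g t" if "m \<le> t" for t
        using T(2) \<open>T \<le> m\<close> that by simp
      show ?thesis
        unfolding N_def
        by (rule decay_probability_bound[where h = h and H = H and c = c]) (fact hH c_def \<alpha> \<alpha>m g growth Q Qe v)+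
    qed
    moreover have "\<bar>err \<alpha> x t y\<bar> \<le> 3 * Q" for x t y using Qe[of x t y] Q(1) by linarith
    moreover have "0 < (1 - \<gamma>)\<^sup>2 / 4096" using gamma by simp
    moreover have "0 < 3 * Q" using Q by simp
    moreover have "1 \<le> N"
    proof -
      have "1 \<le> CARD('s \<times> 'a)" by (metis One_nat_def Suc_leI zero_less_card_finite)
      then have "1 \<le> real CARD('s \<times> 'a)" by (simp only: real_of_nat_ge_one_iff)
      then show ?thesis unfolding N_def by linarith
    qed
    ultimately show "\<exists>C \<kappa> N T. 0 < C \<and> 0 < \<kappa> \<and> 1 \<le> N \<and> (\<forall>x t y. \<bar>err \<alpha> x t y\<bar> \<le> C) \<and>
      (\<forall>m\<ge>T. 1 - N * exp (- \<kappa> / v m)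
        \<le> prob {\<omega> \<in> space M. \<forall>t\<ge>m. \<forall>y. \<bar>err \<alpha> (path \<omega>) t y\<bar> \<le> C * g m / g t})"
      by blast
  qed
qed

end

section \<open>Rates for the two families of step sizes\<close>

text \<open>By the mean value theorem each term is at most a multiple of the drop of
  \<open>(real k + 3) powr (- a)\<close> over one step, and the drops telescope. The power of 2 pays
  for \<open>real k + 4 \<le> 2 * (real k + 3)\<close>.\<close>

lemma powr_tail_sum_le:
  fixes a :: real
  assumes a: "0 < a"
  shows "(\<Sum>k=m..<n. (real k + 3) powr (- (1 + a))) \<le> 2 powr (1 + a) / a * (real m + 3) powr (- a)"
proof -
  define F where "F k = (real k + 3) powr (- a)" for k :: nat
  have step: "(real k + 3) powr (- (1 + a)) \<le> 2 powr (1 + a) / a * (F k - F (Suc k))" for k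
  proof -
    have "\<exists>z. real k + 3 < z \<and> z < real k + 4 \<and>
        (real k + 4) powr (- a) - (real k + 3) powr (- a) = (real k + 4 - (real k + 3)) * (- a * z powr (- a - 1))"
      by (rule MVT2) (auto intro!: derivative_eq_intros simp: field_simps)
    then obtain z where z: "real k + 3 < z" "z < real k + 4"
      "F k - F (Suc k) = a * z powr (- a - 1)"
      by (auto simp: F_def algebra_simps)
    have "(2 * (real k + 3)) powr (- a - 1) \<le> z powr (- a - 1)"
      using z a by (intro powr_mono2') auto
    then have "a * (2 * (real k + 3)) powr (- a - 1) \<le> F k - F (Suc k)"
      unfolding z(3) using a by (intro mult_left_mono) auto
    then have "2 powr (1 + a) / a * (a * (2 * (real k + 3)) powr (- a - 1)) \<le> 2 powr (1 + a) / a * (F k - F (Suc k))"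
      using a by (intro mult_left_mono) auto
    moreover have "2 powr (1 + a) / a * (a * (2 * (real k + 3)) powr (- a - 1)) = (real k + 3) powr (- (1 + a))"
    proof -
      have 1: "(2::real) powr (1 + a) * 2 powr (- a - 1) = 1" by (simp flip: powr_add)
      have "2 powr (1 + a) / a * (a * (2 * (real k + 3)) powr (- a - 1))
          = 2 powr (1 + a) * (2 * (real k + 3)) powr (- a - 1)" using a by simp
      also have "\<dots> = (2 powr (1 + a) * 2 powr (- a - 1)) * (real k + 3) powr (- a - 1)"
        by (simp only: powr_mult mult.assoc)
      also have "\<dots> = (real k + 3) powr (- a - 1)" by (simp only: 1 mult_1_left)
      also have "\<dots> = (real k + 3) powr (- (1 + a))" by (rule arg_cong) simp
      finally show ?thesis .
    qed
    ultimately show ?thesis by simp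
  qed
  have F_nonneg: "0 \<le> F k" for k by (simp add: F_def)
  show ?thesis
  proof (cases "m \<le> n")
    case True
    have "(\<Sum>k=m..<n. (real k + 3) powr (- (1 + a))) \<le> (\<Sum>k=m..<n. 2 powr (1 + a) / a * (F k - F (Suc k)))"
      by (intro sum_mono step)
    also have "\<dots> = 2 powr (1 + a) / a * (F m - F n)"
    proof -
      have "(\<Sum>k=m..<n. F k - F (Suc k)) = F m - F n"
        using sum_Suc_diff'[OF True, of "\<lambda>k. - F k"] by simp
      then show ?thesis by (simp only: sum_distrib_left[symmetric])
    qed
    also have "\<dots> \<le> 2 powr (1 + a) / a * F m" using a F_nonneg by (intro mult_left_mono) auto
    finally show ?thesis by (simp add: F_def)
  next
    case False
    then show ?thesis using a by simp
  qed
qed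

text \<open>Beyond the point \<open>Y\<close> where \<open>y powr b / b\<close> equals
  \<open>y / 2\<close> the linear term wins; before it the left side is bounded. Applied to
  \<open>y = ln x\<close>, it keeps \<open>(g t)\<^sup>2\<close> for logarithmic steps below a
  multiple of a square root.\<close>

lemma powr_le_half_add_const:
  fixes b :: real
  assumes b: "0 < b" "b < 1"
  obtains K where "0 \<le> K" "\<And>y. 0 \<le> y \<Longrightarrow> y powr b / b \<le> y / 2 + K"
proof -
  define Y where "Y = (2 / b) powr (1 / (1 - b))"
  have Y: "0 < Y" using b by (simp add: Y_def)
  have "y powr b / b \<le> y / 2 + Y powr b / b" if y: "0 \<le> y" for y
  proof (cases "y \<le> Y")
    case True
    then have "y powr b \<le> Y powr b" using y b by (intro powr_mono2) auto
    then have "y powr b / b \<le> Y powr b / b" using b by (intro divide_right_mono) auto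
    with y show ?thesis by linarith
  next
    case False
    then have "Y powr (1 - b) \<le> y powr (1 - b)" using Y b by (intro powr_mono2) auto
    moreover have "Y powr (1 - b) = 2 / b" using b by (simp add: Y_def powr_powr)
    ultimately have "2 / b * y powr b \<le> y powr (1 - b) * y powr b" by (intro mult_right_mono) auto
    also have "\<dots> = y" using False Y by (simp flip: powr_add)
    finally have "y powr b / b \<le> y / 2" using b by (simp add: field_simps)
    moreover have "0 \<le> Y powr b / b" using b by simp
    ultimately show ?thesis by linarith
  qed
  moreover have "0 \<le> Y powr b / b" using b by simp
  ultimately show ?thesis using that by blast
qed

text \<open>The left side is the increment over one unit of an antiderivative of the decreasing
  function \<open>1 / (x * ln x powr \<nu>)\<close>. It ties the growth of \<open>g\<close> to the
  logarithmic step size.\<close>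

lemma ln_powr_increment_le:
  fixes x \<nu> :: real
  assumes x: "1 < x" and \<nu>: "0 < \<nu>" "\<nu> < 1"
  shows "ln (x + 1) powr (1 - \<nu>) / (1 - \<nu>) - ln x powr (1 - \<nu>) / (1 - \<nu>) \<le> 1 / (x * ln x powr \<nu>)"
proof -
  have D: "((\<lambda>x. ln x powr (1 - \<nu>) / (1 - \<nu>)) has_real_derivative ln z powr (- \<nu>) / z) (at z)"
    if "x \<le> z" for z
  proof -
    have "((\<lambda>x. ln x powr (1 - \<nu>)) has_real_derivative (1 - \<nu>) * ln z powr (1 - \<nu> - of_nat 1) * (1 / z)) (at z)"
      using x that by (intro DERIV_fun_powr DERIV_ln_divide) auto
    from DERIV_cdivide[OF this, of "1 - \<nu>"] show ?thesis using \<nu> by simp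
  qed
  have "\<exists>z. x < z \<and> z < x + 1 \<and>
      ln (x + 1) powr (1 - \<nu>) / (1 - \<nu>) - ln x powr (1 - \<nu>) / (1 - \<nu>) = (x + 1 - x) * (ln z powr (- \<nu>) / z)"
    by (rule MVT2) (use D in auto)
  then obtain z where z: "x < z" "z < x + 1"
    "ln (x + 1) powr (1 - \<nu>) / (1 - \<nu>) - ln x powr (1 - \<nu>) / (1 - \<nu>) = ln z powr (- \<nu>) / z"
    by auto
  have "ln z powr (- \<nu>) \<le> ln x powr (- \<nu>)" using x z \<nu> by (intro powr_mono2') auto
  then have "ln z powr (- \<nu>) / z \<le> ln x powr (- \<nu>) / x" using x z by (intro frac_le) auto
  also have "\<dots> = 1 / (x * ln x powr \<nu>)" by (simp add: powr_minus field_simps)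
  finally show ?thesis using z(3) by simp
qed

lemma supnorm_le_iff: "supnorm f \<le> c \<longleftrightarrow> (\<forall>s a. \<bar>f s a\<bar> \<le> c)"
  unfolding supnorm_def by (subst Max_le_iff) auto

lemma supnorm_nonneg: "0 \<le> supnorm f"
proof -
  have "\<bar>f undefined undefined\<bar> \<le> supnorm f" using supnorm_le_iff[of f "supnorm f"] by simp
  then show ?thesis by linarith
qed

text \<open>The union of all \<open>E m\<close> contains each of them, so its probability is at
  least \<open>1 - f m\<close> for every large \<open>m\<close>.\<close>

lemma (in prob_space) AE_exists_if_prob_tendsto_1:
  assumes E: "\<And>m. E m \<in> events" and bound: "\<And>m. T \<le> m \<Longrightarrow> 1 - f m \<le> prob (E m)"
    and f: "f \<longlonglongrightarrow> 0"
  shows "AE \<omega> in M. \<exists>m. \<omega> \<in> E m"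
proof -
  have U: "(\<Union>m. E m) \<in> events" using E by auto
  have "1 - 0 \<le> prob (\<Union>m. E m)"
  proof (rule LIMSEQ_le_const2)
    show "(\<lambda>m. 1 - f m) \<longlonglongrightarrow> 1 - 0" by (intro tendsto_intros f)
    show "\<exists>N. \<forall>n\<ge>N. 1 - f n \<le> prob (\<Union>m. E m)"
    proof (intro exI allI impI)
      fix n assume "T \<le> n"
      then show "1 - f n \<le> prob (\<Union>m. E m)"
        using bound[of n] finite_measure_mono[OF _ U, of "E n"] by (auto intro: order_trans)
    qed
  qed
  then have "prob (\<Union>m. E m) = 1" using prob_le_1[of "\<Union>m. E m"] by linarith
  then have "AE \<omega> in M. \<omega> \<in> (\<Union>m. E m)" by (rule AE_prob_1)
  then show ?thesis by simp
qed


section \<open>The maximum norm of the error, and polynomial step sizes\<close>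

context q_learning
begin

definition sup_err :: "(nat \<Rightarrow> real) \<Rightarrow> (nat \<Rightarrow> 's \<times> 'a) \<Rightarrow> nat \<Rightarrow> real" where
  "sup_err \<alpha> x t = supnorm (\<lambda>s a. err \<alpha> x t (s, a))"

lemma sup_err_path:
  "sup_err \<alpha> (path \<omega>) t
    = supnorm (\<lambda>s a. qlearn r \<gamma> \<alpha> q0 (\<lambda>k. S k \<omega>) (\<lambda>k. A k \<omega>) t s a - qstar s a)"
  by (simp add: sup_err_def err_def iterate_def)

lemma sup_err_le_iff: "sup_err \<alpha> x t \<le> C \<longleftrightarrow> (\<forall>y. \<bar>err \<alpha> x t y\<bar> \<le> C)"
  by (simp add: sup_err_def supnorm_le_iff)

lemma sup_err_nonneg: "0 \<le> sup_err \<alpha> x t"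
  by (simp add: sup_err_def supnorm_nonneg)

lemma sup_err_measurable [measurable]: "(\<lambda>\<omega>. sup_err \<alpha> (path \<omega>) t) \<in> borel_measurable M"
proof (rule path_function_measurable)
  show "depends_upto t (\<lambda>x. sup_err \<alpha> x t)"
    unfolding depends_upto_def sup_err_def
  proof (intro allI impI)
    fix x y :: "nat \<Rightarrow> 's \<times> 'a" assume "\<forall>k\<le>t. x k = y k"
    then have "err \<alpha> x t z = err \<alpha> y t z" for z by (intro depends_uptoD[OF err_depends_upto]) auto
    then show "supnorm (\<lambda>s a. err \<alpha> x t (s, a)) = supnorm (\<lambda>s a. err \<alpha> y t (s, a))" by simp
  qed
qed

text \<open>With \<open>g\<close> of order \<open>t powr k\<close>, one step multiplies
  \<open>g\<close> by about \<open>exp (k / t)\<close>, while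
  \<open>exp (c * C\<alpha> / t powr \<nu>)\<close> is allowed: this holds eventually if
  \<open>\<nu> < 1\<close> and asks for \<open>k \<le> c * C\<alpha>\<close> if
  \<open>\<nu> = 1\<close>. The condition \<open>2 * k < 2 * \<nu> - 1\<close> makes the squares of
  \<open>t powr (k - \<nu>)\<close> summable.\<close>

lemma polynomial_steps_decay:
  obtains c where "0 < c" and
    "\<And>C\<alpha> \<nu> k. \<lbrakk>0 < C\<alpha>; \<nu> \<le> 1; 0 < k; 2 * k < 2 * \<nu> - 1; \<nu> < 1 \<or> k \<le> c * C\<alpha>\<rbrakk>
      \<Longrightarrow> AE \<omega> in M. \<exists>K. \<forall>\<^sub>F t in sequentially.
        (sup_err (\<lambda>t. C\<alpha> / (real t + 3) powr \<nu>) (path \<omega>) t)\<^sup>2 \<le> K * (real t + 3) powr (- 2 * k)"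
proof (rule decay_in_probability)
  fix c
  assume c: "0 < c"
    and decay: "\<And>\<alpha> g v. \<lbrakk>\<And>t. 0 \<le> \<alpha> t; \<And>t. \<alpha> (Suc t) \<le> \<alpha> t; \<alpha> \<longlonglongrightarrow> 0;
      \<And>t. 0 < g t; \<And>t. g t \<le> g (Suc t); \<forall>\<^sub>F t in sequentially. g (Suc t) \<le> exp (c * \<alpha> t) * g t;
      \<And>m. 0 < v m; \<And>m n. (\<Sum>k=m..<n. (g (Suc k) * \<alpha> k)\<^sup>2) \<le> v m * (g m)\<^sup>2\<rbrakk>
    \<Longrightarrow> \<exists>C \<kappa> N T. 0 < C \<and> 0 < \<kappa> \<and> 1 \<le> N \<and> (\<forall>x t y. \<bar>err \<alpha> x t y\<bar> \<le> C) \<and>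
      (\<forall>m\<ge>T. 1 - N * exp (- \<kappa> / v m)
        \<le> prob {\<omega> \<in> space M. \<forall>t\<ge>m. \<forall>y. \<bar>err \<alpha> (path \<omega>) t y\<bar> \<le> C * g m / g t})"
  show thesis
  proof (rule that[OF c])
    fix C\<alpha> \<nu> k :: real
    assume C\<alpha>: "0 < C\<alpha>" and \<nu>: "\<nu> \<le> 1" and k: "0 < k" "2 * k < 2 * \<nu> - 1"
      and growth: "\<nu> < 1 \<or> k \<le> c * C\<alpha>"
    define \<alpha> where "\<alpha> t = C\<alpha> / (real t + 3) powr \<nu>" for t
    define g where "g t = (real t + 3) powr k" for t
    define a where "a = 2 * \<nu> - 2 * k - 1"
    have a: "0 < a" using k by (simp add: a_def)
    define V where "V = C\<alpha>\<^sup>2 * 2 powr (2 * k) * (2 powr (1 + a) / a)"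
    have V: "0 < V" using a C\<alpha> by (simp add: V_def)
    \<comment> \<open>The tail of the weighted variances from \<open>m\<close> on is of order
      \<open>m powr (- a)\<close>; dividing by \<open>(g m)\<^sup>2\<close> leaves the power
      \<open>- (2 * \<nu> - 1)\<close>, whatever \<open>k\<close> is.\<close>
    define v where "v m = V * (real m + 3) powr (- (2 * \<nu> - 1))" for m
    have "\<nu> > 0" using k by simp
    have \<alpha>_antimono: "\<alpha> (Suc t) \<le> \<alpha> t" for t
      unfolding \<alpha>_def using C\<alpha> \<open>\<nu> > 0\<close> by (intro divide_left_mono powr_mono2) auto
    have \<alpha>_lim: "\<alpha> \<longlonglongrightarrow> 0"
      unfolding \<alpha>_def using C\<alpha> \<open>\<nu> > 0\<close> by real_asymp
    have g_growth: "\<forall>\<^sub>F t in sequentially. g (Suc t) \<le> exp (c * \<alpha> t) * g t"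
    proof -
      have "\<forall>\<^sub>F t in sequentially. k \<le> c * C\<alpha> * (real t + 3) powr (1 - \<nu>)"
      proof (cases "\<nu> < 1")
        case True
        have "filterlim (\<lambda>t::nat. c * C\<alpha> * (real t + 3) powr (1 - \<nu>)) at_top sequentially"
          using True c C\<alpha> by real_asymp
        then show ?thesis by (simp add: filterlim_at_top)
      next
        case False
        then show ?thesis using growth \<nu> by simp
      qed
      then show ?thesis
      proof eventually_elim
        case (elim t)
        have "k / (real t + 3) \<le> c * C\<alpha> * (real t + 3) powr (1 - \<nu>) / (real t + 3)"
          using elim by (intro divide_right_mono) auto
        also have "\<dots> = c * \<alpha> t" by (simp add: \<alpha>_def powr_diff)
        finally have 1: "k / (real t + 3) \<le> c * \<alpha> t" .
        have "real (Suc t) + 3 = (1 + 1 / (real t + 3)) * (real t + 3)" by (simp add: field_simps)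
        also have "\<dots> \<le> exp (1 / (real t + 3)) * (real t + 3)"
          by (intro mult_right_mono exp_ge_add_one_self) auto
        finally have "real (Suc t) + 3 \<le> exp (1 / (real t + 3)) * (real t + 3)" .
        then have "g (Suc t) \<le> (exp (1 / (real t + 3)) * (real t + 3)) powr k"
          unfolding g_def using k by (intro powr_mono2) auto
        also have "\<dots> = exp (k / (real t + 3)) * g t"
          by (simp add: powr_mult g_def exp_powr_real)
        also have "\<dots> \<le> exp (c * \<alpha> t) * g t"
          using 1 by (intro mult_right_mono) (auto simp: g_def)
        finally show ?case .
      qed
    qed
    have v_sum: "(\<Sum>j=m..<n. (g (Suc j) * \<alpha> j)\<^sup>2) \<le> v m * (g m)\<^sup>2" for m n
    proof -
      have "(g (Suc j) * \<alpha> j)\<^sup>2 \<le> C\<alpha>\<^sup>2 * 2 powr (2 * k) * (real j + 3) powr (- (1 + a))" for j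
      proof -
        have "g (Suc j) \<le> (2 * (real j + 3)) powr k"
          unfolding g_def using k by (intro powr_mono2) auto
        also have "\<dots> = 2 powr k * (real j + 3) powr k" by (rule powr_mult)
        finally have "g (Suc j) * \<alpha> j \<le> 2 powr k * (real j + 3) powr k * \<alpha> j"
          using C\<alpha> by (intro mult_right_mono) (auto simp: \<alpha>_def)
        also have "\<dots> = C\<alpha> * 2 powr k * (real j + 3) powr (k - \<nu>)"
          by (simp add: \<alpha>_def powr_diff)
        finally have "(g (Suc j) * \<alpha> j)\<^sup>2 \<le> (C\<alpha> * 2 powr k * (real j + 3) powr (k - \<nu>))\<^sup>2"
          using C\<alpha> by (intro power_mono) (auto simp: g_def \<alpha>_def)
        also have "\<dots> = C\<alpha>\<^sup>2 * 2 powr (2 * k) * (real j + 3) powr (2 * (k - \<nu>))"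
          by (simp add: power_mult_distrib powr_power mult.commute)
        also have "2 * (k - \<nu>) = - (1 + a)" by (simp add: a_def)
        finally show ?thesis .
      qed
      then have "(\<Sum>j=m..<n. (g (Suc j) * \<alpha> j)\<^sup>2)
          \<le> C\<alpha>\<^sup>2 * 2 powr (2 * k) * (\<Sum>j=m..<n. (real j + 3) powr (- (1 + a)))"
        unfolding sum_distrib_left by (intro sum_mono)
      also have "\<dots> \<le> C\<alpha>\<^sup>2 * 2 powr (2 * k) * (2 powr (1 + a) / a * (real m + 3) powr (- a))"
        by (intro mult_left_mono powr_tail_sum_le a) auto
      also have "\<dots> = V * (real m + 3) powr (- a)" by (simp add: V_def)
      also have "- a = - (2 * \<nu> - 1) + 2 * k" by (simp add: a_def)
      also have "V * (real m + 3) powr (- (2 * \<nu> - 1) + 2 * k) = v m * (g m)\<^sup>2"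
        by (simp only: v_def g_def powr_add powr_power mult.assoc) (simp add: mult.commute)
      finally show ?thesis .
    qed
    have "\<exists>C \<kappa> N T. 0 < C \<and> 0 < \<kappa> \<and> 1 \<le> N \<and> (\<forall>x t y. \<bar>err \<alpha> x t y\<bar> \<le> C) \<and>
      (\<forall>m\<ge>T. 1 - N * exp (- \<kappa> / v m)
        \<le> prob {\<omega> \<in> space M. \<forall>t\<ge>m. \<forall>y. \<bar>err \<alpha> (path \<omega>) t y\<bar> \<le> C * g m / g t})"
    proof (rule decay)
      show "0 \<le> \<alpha> t" for t using C\<alpha> by (simp add: \<alpha>_def)
      show "0 < g t" for t by (simp add: g_def add_pos_nonneg)
      show "g t \<le> g (Suc t)" for t unfolding g_def using k by (intro powr_mono2) auto
      show "0 < v m" for m using V by (simp add: v_def add_pos_nonneg)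
    qed (fact \<alpha>_antimono \<alpha>_lim g_growth v_sum)+
    then obtain C \<kappa> N T where C: "0 < C" and \<kappa>: "0 < \<kappa>" and N: "1 \<le> N"
      and prob_ge: "\<forall>m\<ge>T. 1 - N * exp (- \<kappa> / v m)
        \<le> prob {\<omega> \<in> space M. \<forall>t\<ge>m. \<forall>y. \<bar>err \<alpha> (path \<omega>) t y\<bar> \<le> C * g m / g t}"
      by blast
    have "(\<lambda>m. N * exp (- \<kappa> / v m)) \<longlonglongrightarrow> 0"
    proof -
      have "(\<lambda>m. N * exp (- (\<kappa> / V) * (real m + 3) powr (2 * \<nu> - 1))) \<longlonglongrightarrow> 0"
      proof -
        have "(\<lambda>m::nat. N * exp (- u * (real m + 3) powr w)) \<longlonglongrightarrow> 0"
          if "0 < u" "0 < w" "0 < N" for u w N :: real using that by real_asymp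
        from this[of "\<kappa> / V" "2 * \<nu> - 1" N] show ?thesis using \<kappa> V k N by simp
      qed
      moreover have "- (\<kappa> / V) * (real m + 3) powr (2 * \<nu> - 1) = - \<kappa> / v m" for m
        by (simp only: v_def powr_minus) (simp add: field_simps)
      ultimately show ?thesis by simp
    qed
    then have "AE \<omega> in M. \<exists>m. \<omega> \<in> {\<omega> \<in> space M. \<forall>t\<ge>m. \<forall>y. \<bar>err \<alpha> (path \<omega>) t y\<bar> \<le> C * g m / g t}"
      by (intro AE_exists_if_prob_tendsto_1[OF decay_event_measurable, where T = T]) (use prob_ge in auto)
    then have "AE \<omega> in M. \<exists>K. \<forall>\<^sub>F t in sequentially. (sup_err \<alpha> (path \<omega>) t)\<^sup>2 \<le> K * (real t + 3) powr (- 2 * k)"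
    proof (rule AE_mp, intro AE_I2 impI)
      fix \<omega> assume "\<exists>m. \<omega> \<in> {\<omega> \<in> space M. \<forall>t\<ge>m. \<forall>y. \<bar>err \<alpha> (path \<omega>) t y\<bar> \<le> C * g m / g t}"
      then obtain m where m: "\<And>t y. m \<le> t \<Longrightarrow> \<bar>err \<alpha> (path \<omega>) t y\<bar> \<le> C * g m / g t" by blast
      have "(sup_err \<alpha> (path \<omega>) t)\<^sup>2 \<le> (C * g m)\<^sup>2 * (real t + 3) powr (- 2 * k)" if "m \<le> t" for t
      proof -
        have "sup_err \<alpha> (path \<omega>) t \<le> C * g m / g t" using m[OF that] by (simp add: sup_err_le_iff)
        then have "(sup_err \<alpha> (path \<omega>) t)\<^sup>2 \<le> (C * g m / g t)\<^sup>2"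
          by (intro power_mono sup_err_nonneg)
        also have "\<dots> = (C * g m)\<^sup>2 / (g t)\<^sup>2" by (rule power_divide)
        also have "(g t)\<^sup>2 = (real t + 3) powr (2 * k)"
          by (simp add: g_def powr_power mult.commute)
        also have "(C * g m)\<^sup>2 / (real t + 3) powr (2 * k) = (C * g m)\<^sup>2 * (real t + 3) powr (- 2 * k)"
          by (simp add: powr_minus divide_inverse)
        finally show ?thesis .
      qed
      then show "\<exists>K. \<forall>\<^sub>F t in sequentially. (sup_err \<alpha> (path \<omega>) t)\<^sup>2 \<le> K * (real t + 3) powr (- 2 * k)"
        unfolding eventually_sequentially by blast
    qed
    then show "AE \<omega> in M. \<exists>K. \<forall>\<^sub>F t in sequentially.
        (sup_err (\<lambda>t. C\<alpha> / (real t + 3) powr \<nu>) (path \<omega>) t)\<^sup>2 \<le> K * (real t + 3) powr (- 2 * k)"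
      by (simp only: \<alpha>_def[abs_def])
  qed
qed

end

section \<open>Logarithmically damped step sizes\<close>

context q_learning
begin

lemma logarithmic_steps_decay:
  assumes \<nu>: "0 < \<nu>" "\<nu> < 1"
  obtains Cbar where "\<And>C\<alpha>. \<lbrakk>0 < C\<alpha>; Cbar \<le> C\<alpha>\<rbrakk> \<Longrightarrow>
    \<exists>C C' (K::nat). 0 < K \<and> (\<forall>\<delta>. 0 < \<delta> \<and> \<delta> < 1 \<longrightarrow>
      1 - \<delta> \<le> prob {\<omega> \<in> space M. \<forall>t.
        (sup_err (\<lambda>t. C\<alpha> / ((real t + 3) * ln (real t + 3) powr \<nu>)) (path \<omega>) t)\<^sup>2
          \<le> C * exp (- (ln (real t + 1) powr (1 - \<nu>)) / (1 - \<nu>))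
            * (ln (1 / \<delta>) + C' + ln (real t + 1) powr (1 - \<nu>) / (1 - \<nu>)) ^ K})"
proof (rule decay_in_probability)
  fix c
  assume c: "0 < c"
    and decay: "\<And>\<alpha> g v. \<lbrakk>\<And>t. 0 \<le> \<alpha> t; \<And>t. \<alpha> (Suc t) \<le> \<alpha> t; \<alpha> \<longlonglongrightarrow> 0;
      \<And>t. 0 < g t; \<And>t. g t \<le> g (Suc t); \<forall>\<^sub>F t in sequentially. g (Suc t) \<le> exp (c * \<alpha> t) * g t;
      \<And>m. 0 < v m; \<And>m n. (\<Sum>k=m..<n. (g (Suc k) * \<alpha> k)\<^sup>2) \<le> v m * (g m)\<^sup>2\<rbrakk>
    \<Longrightarrow> \<exists>C \<kappa> N T. 0 < C \<and> 0 < \<kappa> \<and> 1 \<le> N \<and> (\<forall>x t y. \<bar>err \<alpha> x t y\<bar> \<le> C) \<and>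
      (\<forall>m\<ge>T. 1 - N * exp (- \<kappa> / v m)
        \<le> prob {\<omega> \<in> space M. \<forall>t\<ge>m. \<forall>y. \<bar>err \<alpha> (path \<omega>) t y\<bar> \<le> C * g m / g t})"
  show thesis
  \<comment> \<open>The exponent \<open>L / 2\<close> of \<open>g\<close> grows per step by at most
    \<open>1 / 2 * (\<alpha> t / C\<alpha>)\<close>, which is at most \<open>c * \<alpha> t\<close>
    exactly when \<open>1 / 2 \<le> c * C\<alpha>\<close>.\<close>
  proof (rule that[of "1 / (2 * c)"])
    fix C\<alpha> :: real
    assume C\<alpha>: "0 < C\<alpha>" "1 / (2 * c) \<le> C\<alpha>"
    have half: "1 / 2 \<le> c * C\<alpha>" using c C\<alpha>(2) by (simp add: field_simps)
    define \<alpha> where "\<alpha> t = C\<alpha> / ((real t + 3) * ln (real t + 3) powr \<nu>)" for t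
    define L where "L x = ln x powr (1 - \<nu>) / (1 - \<nu>)" for x :: real
    define g where "g t = exp (L (real t + 3) / 2)" for t :: nat
    have ln3: "1 \<le> ln (real t + 3)" for t
    proof -
      have "exp 1 \<le> (3::real)" by (rule exp_le)
      then have "exp 1 \<le> real t + 3" by linarith
      then show ?thesis by (subst ln_ge_iff) auto
    qed
    have ln_powr_ge: "1 \<le> ln (real t + 3) powr \<nu>" for t
      using ln3[of t] \<nu> by (simp add: ge_one_powr_ge_zero)
    have L_mono: "L x \<le> L y" if "1 \<le> x" "x \<le> y" for x y
      unfolding L_def using that \<nu> by (intro divide_right_mono powr_mono2) auto
    have L_nonneg: "0 \<le> L x" for x using \<nu> by (simp add: L_def)
    have "0 < 1 - \<nu>" "1 - \<nu> < 1" using \<nu> by auto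
    then obtain K where K: "0 \<le> K" "\<And>y. 0 \<le> y \<Longrightarrow> y powr (1 - \<nu>) / (1 - \<nu>) \<le> y / 2 + K"
      by (rule powr_le_half_add_const) (rule that)
    have exp_L: "exp (L x) \<le> exp K * x powr (1 / 2)" if "1 \<le> x" for x
    proof -
      have "L x \<le> ln x / 2 + K" unfolding L_def using that by (intro K(2)) auto
      then have "exp (L x) \<le> exp (ln x / 2 + K)" by simp
      also have "\<dots> = exp K * x powr (1 / 2)" using that by (simp add: powr_def exp_add)
      finally show ?thesis .
    qed
    have \<alpha>_nonneg: "0 \<le> \<alpha> t" for t using C\<alpha> by (simp add: \<alpha>_def)
    have \<alpha>_le: "\<alpha> t \<le> C\<alpha> / (real t + 3)" for t
    proof -
      have "(real t + 3) * 1 \<le> (real t + 3) * ln (real t + 3) powr \<nu>"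
        using ln_powr_ge by (intro mult_left_mono) auto
      then show ?thesis unfolding \<alpha>_def using C\<alpha> by (intro divide_left_mono) auto
    qed
    have \<alpha>_antimono: "\<alpha> (Suc t) \<le> \<alpha> t" for t
    proof -
      have "ln (real t + 3) powr \<nu> \<le> ln (real (Suc t) + 3) powr \<nu>"
        using \<nu> ln3[of t] by (intro powr_mono2) auto
      then have "(real t + 3) * ln (real t + 3) powr \<nu> \<le> (real (Suc t) + 3) * ln (real (Suc t) + 3) powr \<nu>"
        by (intro mult_mono) auto
      moreover have "0 < (real t + 3) * ln (real t + 3) powr \<nu>"
        using ln_powr_ge[of t] by (intro mult_pos_pos) linarith+
      ultimately show ?thesis unfolding \<alpha>_def using C\<alpha>
        by (intro divide_left_mono) (auto intro: mult_pos_pos less_le_trans)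
    qed
    have \<alpha>_lim: "\<alpha> \<longlonglongrightarrow> 0"
    proof (rule tendsto_sandwich[OF _ _ tendsto_const])
      show "(\<lambda>t. C\<alpha> / (real t + 3)) \<longlonglongrightarrow> 0" by real_asymp
    qed (use \<alpha>_nonneg \<alpha>_le in auto)
    have g_growth: "g (Suc t) \<le> exp (c * \<alpha> t) * g t" for t
    proof -
      have "L (real (Suc t) + 3) - L (real t + 3) \<le> 1 / ((real t + 3) * ln (real t + 3) powr \<nu>)"
        using ln_powr_increment_le[of "real t + 3" \<nu>] \<nu> by (simp add: L_def add_ac)
      then have "L (real (Suc t) + 3) / 2 - L (real t + 3) / 2
          \<le> 1 / 2 * (1 / ((real t + 3) * ln (real t + 3) powr \<nu>))" by linarith
      also have "\<dots> \<le> c * C\<alpha> * (1 / ((real t + 3) * ln (real t + 3) powr \<nu>))"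
        using half by (intro mult_right_mono) auto
      also have "\<dots> = c * \<alpha> t" by (simp add: \<alpha>_def)
      finally have "L (real (Suc t) + 3) / 2 \<le> c * \<alpha> t + L (real t + 3) / 2" by linarith
      then show ?thesis unfolding g_def exp_add[symmetric] by simp
    qed
    \<comment> \<open>\<open>(g t)\<^sup>2\<close> is at most of the order of a square root and the
      step at most \<open>C\<alpha> / (real t + 3)\<close>, so the weighted variances decay with
      power \<open>-3/2\<close> and their tails with power \<open>-1/2\<close>.\<close>
    define V where "V = C\<alpha>\<^sup>2 * (2 * exp K) * (2 powr (1 + 1 / 2) / (1 / 2))"
    have V: "0 < V" using C\<alpha> by (simp add: V_def)
    define v where "v m = V * (real m + 3) powr (- (1 / 2))" for m :: nat
    have g_ge_1: "1 \<le> g t" for t using L_nonneg by (simp add: g_def)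
    have g_sq: "(g t)\<^sup>2 = exp (L (real t + 3))" for t
      by (simp add: g_def power2_eq_square flip: exp_add)
    have v_sum: "(\<Sum>j=m..<n. (g (Suc j) * \<alpha> j)\<^sup>2) \<le> v m * (g m)\<^sup>2" for m n
    proof -
      have "(g (Suc j) * \<alpha> j)\<^sup>2 \<le> C\<alpha>\<^sup>2 * (2 * exp K) * (real j + 3) powr (- (1 + 1 / 2))" for j
      proof -
        have "(g (Suc j))\<^sup>2 \<le> exp K * (real (Suc j) + 3) powr (1 / 2)"
          unfolding g_sq by (rule exp_L) simp
        also have "(real (Suc j) + 3) powr (1 / 2) \<le> (4 * (real j + 3)) powr (1 / 2)"
          by (intro powr_mono2) auto
        also have "\<dots> = 2 * (real j + 3) powr (1 / 2)"
          by (simp only: powr_mult) (simp add: powr_half_sqrt)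
        finally have 1: "(g (Suc j))\<^sup>2 \<le> 2 * exp K * (real j + 3) powr (1 / 2)" by simp
        have "(\<alpha> j)\<^sup>2 \<le> (C\<alpha> / (real j + 3))\<^sup>2"
          using \<alpha>_le \<alpha>_nonneg by (intro power_mono) auto
        also have "\<dots> = C\<alpha>\<^sup>2 * (real j + 3) powr (- 2)"
          by (simp add: powr_minus powr_numeral divide_inverse power_mult_distrib power_inverse)
        finally have 2: "(\<alpha> j)\<^sup>2 \<le> C\<alpha>\<^sup>2 * (real j + 3) powr (- 2)" .
        have "(g (Suc j) * \<alpha> j)\<^sup>2 \<le> (2 * exp K * (real j + 3) powr (1 / 2)) * (C\<alpha>\<^sup>2 * (real j + 3) powr (- 2))"
          unfolding power_mult_distrib using 1 2 by (intro mult_mono) auto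
        also have "\<dots> = C\<alpha>\<^sup>2 * (2 * exp K) * ((real j + 3) powr (1 / 2) * (real j + 3) powr (- 2))"
          by simp
        also have "(real j + 3) powr (1 / 2) * (real j + 3) powr (- 2) = (real j + 3) powr (- (1 + 1 / 2))"
          by (simp flip: powr_add)
        finally show ?thesis .
      qed
      then have "(\<Sum>j=m..<n. (g (Suc j) * \<alpha> j)\<^sup>2)
          \<le> C\<alpha>\<^sup>2 * (2 * exp K) * (\<Sum>j=m..<n. (real j + 3) powr (- (1 + 1 / 2)))"
        unfolding sum_distrib_left by (intro sum_mono)
      also have "\<dots> \<le> C\<alpha>\<^sup>2 * (2 * exp K) * (2 powr (1 + 1 / 2) / (1 / 2) * (real m + 3) powr (- (1 / 2)))"
        by (intro mult_left_mono powr_tail_sum_le) auto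
      also have "\<dots> = v m * 1" by (simp add: V_def v_def)
      also have "\<dots> \<le> v m * (g m)\<^sup>2"
        using g_ge_1[of m] V by (intro mult_left_mono) (auto simp: v_def)
      finally show ?thesis .
    qed
    have "\<exists>C \<kappa> N T. 0 < C \<and> 0 < \<kappa> \<and> 1 \<le> N \<and> (\<forall>x t y. \<bar>err \<alpha> x t y\<bar> \<le> C) \<and>
      (\<forall>m\<ge>T. 1 - N * exp (- \<kappa> / v m)
        \<le> prob {\<omega> \<in> space M. \<forall>t\<ge>m. \<forall>y. \<bar>err \<alpha> (path \<omega>) t y\<bar> \<le> C * g m / g t})"
    proof (rule decay)
      show "0 < g t" for t by (simp add: g_def)
      show "g t \<le> g (Suc t)" for t unfolding g_def by (simp add: L_mono)
      show "\<forall>\<^sub>F t in sequentially. g (Suc t) \<le> exp (c * \<alpha> t) * g t" using g_growth by simp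
      show "0 < v m" for m using V by (simp add: v_def add_pos_nonneg)
    qed (fact \<alpha>_nonneg \<alpha>_antimono \<alpha>_lim v_sum)+
    then obtain C \<kappa> N T where C: "0 < C" "\<And>x t y. \<bar>err \<alpha> x t y\<bar> \<le> C" and \<kappa>: "0 < \<kappa>" and N: "1 \<le> N"
      and prob_ge: "\<And>m. T \<le> m \<Longrightarrow> 1 - N * exp (- \<kappa> / v m)
        \<le> prob {\<omega> \<in> space M. \<forall>t\<ge>m. \<forall>y. \<bar>err \<alpha> (path \<omega>) t y\<bar> \<le> C * g m / g t}"
      by blast
    define R where "R = V / \<kappa>"
    have R: "0 < R" using V \<kappa> by (simp add: R_def)
    \<comment> \<open>\<open>ln N\<close> absorbs the prefactor of the failure probability; the
      extra 1 gives \<open>u \<ge> 1\<close> below, so that additive constants can be absorbed into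
      \<open>u\<^sup>2\<close>.\<close>
    define C' where "C' = ln N + 1"
    define D where "D = C\<^sup>2 * exp K * (R\<^sup>2 + 4 + real T)"
    have D: "0 \<le> D" by (simp add: D_def)
    let ?B = "\<lambda>\<delta> t. D * exp (- (ln (real t + 1) powr (1 - \<nu>)) / (1 - \<nu>))
            * (ln (1 / \<delta>) + C' + ln (real t + 1) powr (1 - \<nu>) / (1 - \<nu>)) ^ 2"
    have "1 - \<delta> \<le> prob {\<omega> \<in> space M. \<forall>t. (sup_err \<alpha> (path \<omega>) t)\<^sup>2 \<le> ?B \<delta> t}"
      if \<delta>: "0 < \<delta>" "\<delta> < 1" for \<delta>
    proof -
      define u where "u = ln (1 / \<delta>) + C'"
      have lnN: "0 \<le> ln N" using N by simp
      have ln\<delta>: "0 < ln (1 / \<delta>)" using \<delta> by (intro ln_gt_zero) auto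
      have u: "1 \<le> u" using lnN ln\<delta> by (simp add: u_def C'_def)
      \<comment> \<open>Since \<open>\<kappa> / v m = sqrt (real m + 3) / R\<close>, it is enough
        that \<open>real m + 3\<close> reaches \<open>(R * u)\<^sup>2\<close> for the failure
        probability to fall to \<open>\<delta>\<close>. Adding \<open>T\<close> enters the range
        where the estimate is available.\<close>
      define m where "m = nat \<lceil>(R * u)\<^sup>2\<rceil> + T"
      have m_lower: "(R * u)\<^sup>2 \<le> real m + 3"
      proof -
        have "(R * u)\<^sup>2 \<le> real (nat \<lceil>(R * u)\<^sup>2\<rceil>)" by (rule real_nat_ceiling_ge)
        then show ?thesis unfolding m_def of_nat_add by linarith
      qed
      have m_upper: "real m + 3 \<le> (R\<^sup>2 + 4 + real T) * u\<^sup>2"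
      proof -
        define z where "z = real (nat \<lceil>(R * u)\<^sup>2\<rceil>)"
        have "z \<le> R\<^sup>2 * u\<^sup>2 + 1"
          using of_int_ceiling_le_add_one[of "(R * u)\<^sup>2"] by (simp add: z_def power_mult_distrib)
        moreover have "real m = z + real T" unfolding m_def of_nat_add z_def ..
        ultimately have "real m + 3 \<le> R\<^sup>2 * u\<^sup>2 + (4 + real T) * 1" by simp
        also have "\<dots> \<le> R\<^sup>2 * u\<^sup>2 + (4 + real T) * u\<^sup>2"
          using u by (intro add_left_mono mult_left_mono) auto
        finally show ?thesis by (simp add: algebra_simps)
      qed
      have fail: "N * exp (- \<kappa> / v m) \<le> \<delta>"
      proof -
        have "R * u \<le> sqrt (real m + 3)" using m_lower R u by (intro real_le_rsqrt)
        then have "u \<le> sqrt (real m + 3) / R" using R by (simp add: field_simps)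
        also have "\<dots> = \<kappa> / v m"
          using V \<kappa> by (simp add: R_def v_def powr_minus powr_half_sqrt field_simps)
        finally have "ln (1 / \<delta>) + ln N \<le> \<kappa> / v m" by (simp add: u_def C'_def)
        then have "exp (- (\<kappa> / v m)) \<le> exp (- (ln (1 / \<delta>) + ln N))" by simp
        also have "\<dots> = \<delta> / N" using \<delta> N by (simp add: exp_diff exp_minus ln_div exp_add field_simps)
        finally show ?thesis using N by (simp add: field_simps)
      qed
      have bound: "(sup_err \<alpha> (path \<omega>) t)\<^sup>2 \<le> ?B \<delta> t"
        if \<omega>: "\<forall>t\<ge>m. \<forall>y. \<bar>err \<alpha> (path \<omega>) t y\<bar> \<le> C * g m / g t" for \<omega> t
      proof -
        have "sup_err \<alpha> (path \<omega>) t \<le> C * (g m / g t)"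
        proof (cases "m \<le> t")
          case True
          then show ?thesis using \<omega> by (simp add: sup_err_le_iff)
        next
          \<comment> \<open>Before time \<open>m\<close> the uniform bound \<open>C\<close>
            suffices, because \<open>g t \<le> g m\<close>; this extends the estimate to all
            times.\<close>
          case False
          have gt: "0 < g t" by (simp add: g_def)
          have "g t \<le> g m" using False by (simp add: g_def L_mono)
          then have "C * 1 \<le> C * (g m / g t)" using C gt by (intro mult_left_mono) (auto simp: field_simps)
          moreover have "sup_err \<alpha> (path \<omega>) t \<le> C" using C by (simp add: sup_err_le_iff)
          ultimately show ?thesis by linarith
        qed
        then have "(sup_err \<alpha> (path \<omega>) t)\<^sup>2 \<le> (C * (g m / g t))\<^sup>2"
          by (intro power_mono sup_err_nonneg)
        also have "\<dots> = C\<^sup>2 * exp (L (real m + 3)) * exp (- L (real t + 3))"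
          by (simp add: power_mult_distrib power_divide g_sq exp_minus field_simps)
        also have "\<dots> \<le> C\<^sup>2 * (exp K * ((R\<^sup>2 + 4 + real T) * u\<^sup>2)) * exp (- L (real t + 1))"
        proof (intro mult_mono mult_left_mono)
          have "exp (L (real m + 3)) \<le> exp K * (real m + 3) powr (1 / 2)" by (rule exp_L) simp
          also have "\<dots> \<le> exp K * (real m + 3) powr 1" by (intro mult_left_mono powr_mono) auto
          also have "\<dots> = exp K * (real m + 3)" by simp
          also have "\<dots> \<le> exp K * ((R\<^sup>2 + 4 + real T) * u\<^sup>2)" using m_upper by (intro mult_left_mono) auto
          finally show "exp (L (real m + 3)) \<le> exp K * ((R\<^sup>2 + 4 + real T) * u\<^sup>2)" .
          show "exp (- L (real t + 3)) \<le> exp (- L (real t + 1))" by (simp add: L_mono)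
        qed auto
        also have "\<dots> = D * exp (- L (real t + 1)) * u\<^sup>2" by (simp add: D_def)
        also have "\<dots> \<le> D * exp (- L (real t + 1)) * (u + L (real t + 1))\<^sup>2"
          using u D L_nonneg by (intro mult_left_mono power_mono) auto
        finally show ?thesis by (simp add: u_def L_def)
      qed
      have "1 - \<delta> \<le> 1 - N * exp (- \<kappa> / v m)" using fail by simp
      also have "\<dots> \<le> prob {\<omega> \<in> space M. \<forall>t\<ge>m. \<forall>y. \<bar>err \<alpha> (path \<omega>) t y\<bar> \<le> C * g m / g t}"
        by (rule prob_ge) (simp add: m_def)
      also have "\<dots> \<le> prob {\<omega> \<in> space M. \<forall>t. (sup_err \<alpha> (path \<omega>) t)\<^sup>2 \<le> ?B \<delta> t}"
      proof (rule finite_measure_mono)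
        show "{\<omega> \<in> space M. \<forall>t\<ge>m. \<forall>y. \<bar>err \<alpha> (path \<omega>) t y\<bar> \<le> C * g m / g t}
            \<subseteq> {\<omega> \<in> space M. \<forall>t. (sup_err \<alpha> (path \<omega>) t)\<^sup>2 \<le> ?B \<delta> t}"
          using bound by blast
        show "{\<omega> \<in> space M. \<forall>t. (sup_err \<alpha> (path \<omega>) t)\<^sup>2 \<le> ?B \<delta> t} \<in> events"
          by measurable
      qed
      finally show ?thesis .
    qed
    then have "\<exists>C C' (K::nat). 0 < K \<and> (\<forall>\<delta>. 0 < \<delta> \<and> \<delta> < 1 \<longrightarrow>
      1 - \<delta> \<le> prob {\<omega> \<in> space M. \<forall>t. (sup_err \<alpha> (path \<omega>) t)\<^sup>2
          \<le> C * exp (- (ln (real t + 1) powr (1 - \<nu>)) / (1 - \<nu>))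
            * (ln (1 / \<delta>) + C' + ln (real t + 1) powr (1 - \<nu>) / (1 - \<nu>)) ^ K})"
      by (intro exI[of _ D] exI[of _ C'] exI[of _ 2]) auto
    then show "\<exists>C C' (K::nat). 0 < K \<and> (\<forall>\<delta>. 0 < \<delta> \<and> \<delta> < 1 \<longrightarrow>
      1 - \<delta> \<le> prob {\<omega> \<in> space M. \<forall>t.
        (sup_err (\<lambda>t. C\<alpha> / ((real t + 3) * ln (real t + 3) powr \<nu>)) (path \<omega>) t)\<^sup>2
          \<le> C * exp (- (ln (real t + 1) powr (1 - \<nu>)) / (1 - \<nu>))
            * (ln (1 / \<delta>) + C' + ln (real t + 1) powr (1 - \<nu>) / (1 - \<nu>)) ^ K})"
      by (simp only: \<alpha>_def[abs_def])
  qed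
qed

end

theorem theorem3:
  fixes M :: "'w measure"
    and S :: "nat \<Rightarrow> 'w \<Rightarrow> 's::finite"
    and A :: "nat \<Rightarrow> 'w \<Rightarrow> 'a::finite"
    and r :: "'s \<Rightarrow> 'a \<Rightarrow> real"
    and p :: "'s \<Rightarrow> 'a \<Rightarrow> 's \<Rightarrow> real"
    and p0 :: "'s \<Rightarrow> real"
    and mu :: "'s \<Rightarrow> 'a \<Rightarrow> real"
    and \<gamma> :: real
    and q0 qstar :: "'s \<Rightarrow> 'a \<Rightarrow> real"
  assumes M: "prob_space M"
    and S_meas: "\<And>t. S t \<in> measurable M (count_space UNIV)"
    and A_meas: "\<And>t. A t \<in> measurable M (count_space UNIV)"
    and p_nonneg: "\<And>s a s'. p s a s' \<ge> 0"
    and p_sum: "\<And>s a. (\<Sum>s'\<in>UNIV. p s a s') = 1"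
    and p0_nonneg: "\<And>s. p0 s \<ge> 0"
    and p0_sum: "(\<Sum>s\<in>UNIV. p0 s) = 1"
    and mu_nonneg: "\<And>s a. mu s a \<ge> 0"
    and mu_sum: "\<And>s. (\<Sum>a\<in>UNIV. mu s a) = 1"
    and gamma: "0 \<le> \<gamma>" "\<gamma> < 1"
    and law: "\<And>n (s :: nat \<Rightarrow> 's) (a :: nat \<Rightarrow> 'a).
       measure M {\<omega> \<in> space M. \<forall>k\<le>n. S k \<omega> = s k \<and> A k \<omega> = a k}
       = p0 (s 0) * mu (s 0) (a 0)
         * (\<Prod>k<n. p (s k) (a k) (s (Suc k)) * mu (s (Suc k)) (a (Suc k)))"
    and irred: "chain_irreducible mu p (triple_space p)"
    and aper: "chain_aperiodic mu p (triple_space p)"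
    and qstar: "bellman r \<gamma> p qstar = qstar"
  shows
   "(\<forall>C\<alpha> \<nu>. 0 < C\<alpha> \<and> 2/3 < \<nu> \<and> \<nu> \<le> 1 \<longrightarrow>
      (let \<alpha> = (\<lambda>t. C\<alpha> / (real t + 3) powr \<nu>) in
        (\<nu> < 1 \<longrightarrow> (\<forall>\<zeta>. 0 < \<zeta> \<and> \<zeta> < 3/2 * \<nu> - 1 \<longrightarrow>
            (AE \<omega> in M. (\<lambda>t. real t powr \<zeta> *
                 (supnorm (\<lambda>s a. qlearn r \<gamma> \<alpha> q0 (\<lambda>k. S k \<omega>) (\<lambda>k. A k \<omega>) t s a - qstar s a))\<^sup>2)
               \<longlonglongrightarrow> 0)))
      \<and> (\<nu> = 1 \<longrightarrow> (\<forall>\<zeta> \<nu>1. 0 < \<zeta> \<and> \<zeta> < 1 \<and> 0 < \<nu>1 \<longrightarrow>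
            (AE \<omega> in M. (\<lambda>t. exp (\<zeta> * ln (real t) powr (1 / (1 + \<nu>1))) *
                 (supnorm (\<lambda>s a. qlearn r \<gamma> \<alpha> q0 (\<lambda>k. S k \<omega>) (\<lambda>k. A k \<omega>) t s a - qstar s a))\<^sup>2)
               \<longlonglongrightarrow> 0)))))
    \<and> (\<forall>\<nu>. 0 < \<nu> \<and> \<nu> < 1 \<longrightarrow>
      (\<exists>Cbar. \<forall>C\<alpha>. 0 < C\<alpha> \<and> Cbar \<le> C\<alpha> \<longrightarrow>
        (let \<alpha> = (\<lambda>t. C\<alpha> / ((real t + 3) * ln (real t + 3) powr \<nu>)) in
          \<exists>C C' (K::nat). 0 < K \<and>
            (\<forall>\<delta>. 0 < \<delta> \<and> \<delta> < 1 \<longrightarrow>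
              measure M {\<omega> \<in> space M. \<forall>t.
                 (supnorm (\<lambda>s a. qlearn r \<gamma> \<alpha> q0 (\<lambda>k. S k \<omega>) (\<lambda>k. A k \<omega>) t s a - qstar s a))\<^sup>2
                 \<le> C * exp (- (ln (real t + 1) powr (1 - \<nu>)) / (1 - \<nu>))
                     * (ln (1 / \<delta>) + C' + ln (real t + 1) powr (1 - \<nu>) / (1 - \<nu>)) ^ K}
              \<ge> 1 - \<delta>))))"
proof -
  interpret q_learning M S A r p p0 mu \<gamma> q0 qstar
    by (intro q_learning.intro q_learning_axioms.intro) fact+
  show ?thesis
  proof (intro conjI allI impI)
    fix C\<alpha> \<nu> :: real
    assume *: "0 < C\<alpha> \<and> 2/3 < \<nu> \<and> \<nu> \<le> 1"
    define \<alpha> where "\<alpha> = (\<lambda>t. C\<alpha> / (real t + 3) powr \<nu>)"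
    obtain c where c: "0 < c" and decay:
      "\<And>C\<alpha> \<nu> k. \<lbrakk>0 < C\<alpha>; \<nu> \<le> 1; 0 < k; 2 * k < 2 * \<nu> - 1; \<nu> < 1 \<or> k \<le> c * C\<alpha>\<rbrakk>
        \<Longrightarrow> AE \<omega> in M. \<exists>K. \<forall>\<^sub>F t in sequentially.
          (sup_err (\<lambda>t. C\<alpha> / (real t + 3) powr \<nu>) (path \<omega>) t)\<^sup>2 \<le> K * (real t + 3) powr (- 2 * k)"
      by (rule polynomial_steps_decay) (rule that)
    have limit: "AE \<omega> in M. (\<lambda>t. w t * (sup_err \<alpha> (path \<omega>) t)\<^sup>2) \<longlonglongrightarrow> 0"
      if k: "0 < k" "2 * k < 2 * \<nu> - 1" "\<nu> < 1 \<or> k \<le> c * C\<alpha>" and w: "\<And>t. 0 \<le> w t"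
        and lim: "(\<lambda>t. w t * (real t + 3) powr (- 2 * k)) \<longlonglongrightarrow> 0" for k and w :: "nat \<Rightarrow> real"
    proof -
      have "AE \<omega> in M. \<exists>K. \<forall>\<^sub>F t in sequentially. (sup_err \<alpha> (path \<omega>) t)\<^sup>2 \<le> K * (real t + 3) powr (- 2 * k)"
        unfolding \<alpha>_def using * k by (intro decay) auto
      then show ?thesis
      proof (rule AE_mp, intro AE_I2 impI)
        fix \<omega> assume "\<exists>K. \<forall>\<^sub>F t in sequentially. (sup_err \<alpha> (path \<omega>) t)\<^sup>2 \<le> K * (real t + 3) powr (- 2 * k)"
        then obtain K where K: "\<forall>\<^sub>F t in sequentially. (sup_err \<alpha> (path \<omega>) t)\<^sup>2 \<le> K * (real t + 3) powr (- 2 * k)" ..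
        show "(\<lambda>t. w t * (sup_err \<alpha> (path \<omega>) t)\<^sup>2) \<longlonglongrightarrow> 0"
        proof (rule tendsto_sandwich[OF _ _ tendsto_const])
          show "\<forall>\<^sub>F t in sequentially. 0 \<le> w t * (sup_err \<alpha> (path \<omega>) t)\<^sup>2" using w by simp
          show "\<forall>\<^sub>F t in sequentially. w t * (sup_err \<alpha> (path \<omega>) t)\<^sup>2
              \<le> K * (w t * (real t + 3) powr (- 2 * k))"
            using K
          proof eventually_elim
            case (elim t)
            from mult_left_mono[OF this w[of t]] show ?case by (simp add: mult_ac)
          qed
          show "(\<lambda>t. K * (w t * (real t + 3) powr (- 2 * k))) \<longlonglongrightarrow> 0"
            using tendsto_mult_right_zero[OF lim] .
        qed
      qed
    qed
    have "AE \<omega> in M. (\<lambda>t. real t powr \<zeta> * (sup_err \<alpha> (path \<omega>) t)\<^sup>2) \<longlonglongrightarrow> 0"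
      if "\<nu> < 1" and \<zeta>: "0 < \<zeta>" "\<zeta> < 3/2 * \<nu> - 1" for \<zeta>
    proof -
      \<comment> \<open>\<open>2 * k\<close> is the midpoint of \<open>\<zeta>\<close> and
        \<open>2 * \<nu> - 1\<close>, which are in this order because
        \<open>3/2 * \<nu> - 1 < 2 * \<nu> - 1\<close>.\<close>
      define k where "k = (\<zeta> + 2 * \<nu> - 1) / 4"
      have k: "0 < k" "2 * k < 2 * \<nu> - 1" "\<zeta> < 2 * k" using \<zeta> * by (auto simp: k_def)
      show ?thesis
      proof (rule limit[OF k(1,2)])
        show "\<nu> < 1 \<or> k \<le> c * C\<alpha>" using that by simp
        show "(\<lambda>t. real t powr \<zeta> * (real t + 3) powr (- 2 * k)) \<longlonglongrightarrow> 0"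
          using \<zeta>(1) k(1,3) by real_asymp
      qed simp
    qed
    moreover have "AE \<omega> in M. (\<lambda>t. exp (\<zeta> * ln (real t) powr (1 / (1 + \<nu>1))) * (sup_err \<alpha> (path \<omega>) t)\<^sup>2) \<longlonglongrightarrow> 0"
      if "\<nu> = 1" and \<zeta>: "0 < \<zeta>" and \<nu>1: "0 < \<nu>1" for \<zeta> \<nu>1
    proof -
      \<comment> \<open>Any positive exponent will do, since
        \<open>exp (\<zeta> * ln t powr b)\<close> with \<open>b < 1\<close> grows slower than every
        power of \<open>t\<close>; the value 1/4 keeps \<open>2 * k\<close> below
        \<open>2 * \<nu> - 1 = 1\<close>.\<close>
      define k where "k = min (c * C\<alpha>) (1 / 4)"
      have k: "0 < k" "2 * k < 2 * \<nu> - 1" "k \<le> c * C\<alpha>" using c * that by (auto simp: k_def)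
      define b where "b = 1 / (1 + \<nu>1)"
      have b: "0 < b" "b < 1" using \<nu>1 by (auto simp: b_def)
      have "(\<lambda>t. exp (\<zeta> * ln (real t) powr b) * (real t + 3) powr (- 2 * k)) \<longlonglongrightarrow> 0"
        using \<zeta> k(1) b by real_asymp
      then show ?thesis unfolding b_def by (intro limit[OF k(1,2)]) (use k in auto)
    qed
    ultimately show "let \<alpha> = (\<lambda>t. C\<alpha> / (real t + 3) powr \<nu>) in
        (\<nu> < 1 \<longrightarrow> (\<forall>\<zeta>. 0 < \<zeta> \<and> \<zeta> < 3/2 * \<nu> - 1 \<longrightarrow>
            (AE \<omega> in M. (\<lambda>t. real t powr \<zeta> *
                 (supnorm (\<lambda>s a. qlearn r \<gamma> \<alpha> q0 (\<lambda>k. S k \<omega>) (\<lambda>k. A k \<omega>) t s a - qstar s a))\<^sup>2)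
               \<longlonglongrightarrow> 0)))
      \<and> (\<nu> = 1 \<longrightarrow> (\<forall>\<zeta> \<nu>1. 0 < \<zeta> \<and> \<zeta> < 1 \<and> 0 < \<nu>1 \<longrightarrow>
            (AE \<omega> in M. (\<lambda>t. exp (\<zeta> * ln (real t) powr (1 / (1 + \<nu>1))) *
                 (supnorm (\<lambda>s a. qlearn r \<gamma> \<alpha> q0 (\<lambda>k. S k \<omega>) (\<lambda>k. A k \<omega>) t s a - qstar s a))\<^sup>2)
               \<longlonglongrightarrow> 0)))"
      unfolding Let_def \<alpha>_def sup_err_path by blast
  next
    fix \<nu> :: real
    assume "0 < \<nu> \<and> \<nu> < 1"
    then have \<nu>: "0 < \<nu>" "\<nu> < 1" by auto
    obtain Cbar where Cbar: "\<And>C\<alpha>. \<lbrakk>0 < C\<alpha>; Cbar \<le> C\<alpha>\<rbrakk> \<Longrightarrow>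
      \<exists>C C' (K::nat). 0 < K \<and> (\<forall>\<delta>. 0 < \<delta> \<and> \<delta> < 1 \<longrightarrow>
        1 - \<delta> \<le> prob {\<omega> \<in> space M. \<forall>t.
          (sup_err (\<lambda>t. C\<alpha> / ((real t + 3) * ln (real t + 3) powr \<nu>)) (path \<omega>) t)\<^sup>2
            \<le> C * exp (- (ln (real t + 1) powr (1 - \<nu>)) / (1 - \<nu>))
              * (ln (1 / \<delta>) + C' + ln (real t + 1) powr (1 - \<nu>) / (1 - \<nu>)) ^ K})"
      by (rule logarithmic_steps_decay[OF \<nu>]) (rule that)
    show "\<exists>Cbar. \<forall>C\<alpha>. 0 < C\<alpha> \<and> Cbar \<le> C\<alpha> \<longrightarrow>
        (let \<alpha> = (\<lambda>t. C\<alpha> / ((real t + 3) * ln (real t + 3) powr \<nu>)) in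
          \<exists>C C' (K::nat). 0 < K \<and>
            (\<forall>\<delta>. 0 < \<delta> \<and> \<delta> < 1 \<longrightarrow>
              measure M {\<omega> \<in> space M. \<forall>t.
                 (supnorm (\<lambda>s a. qlearn r \<gamma> \<alpha> q0 (\<lambda>k. S k \<omega>) (\<lambda>k. A k \<omega>) t s a - qstar s a))\<^sup>2
                 \<le> C * exp (- (ln (real t + 1) powr (1 - \<nu>)) / (1 - \<nu>))
                     * (ln (1 / \<delta>) + C' + ln (real t + 1) powr (1 - \<nu>) / (1 - \<nu>)) ^ K}
              \<ge> 1 - \<delta>))"
      using Cbar unfolding Let_def sup_err_path by blast
  qed
qed

end
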